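(* Let $L \in C^1([a,b]\times \mathbb{R}^{2n}\times \mathbb{R};\mathbb{R})$, $\alpha\in\mathbb{R}^n$, $\gamma\in\mathbb{R}$. If $(x(\cdot),z(\cdot))$ is an extremizer to Herglotz's problem $(P_H)$, then the Euler--Lagrange equation $$ \frac{\partial L}{\partial x}\langle x, z \rangle(t) -\frac{d}{dt}\left(\frac{\partial L}{\partial \dot{x}}\right)\langle x, z \rangle(t) +\frac{\partial L}{\partial z}\langle x, z \rangle(t) \frac{\partial L}{\partial \dot{x}}\langle x, z \rangle(t) = 0 $$ holds, $t \in [a,b]$. Moreover, the following transversality condition holds: $$ \frac{\partial L}{\partial \dot{x}}\langle x,z\rangle(b)=0. $$
   Context: Herglotz's problem $(P_H)$: given $L \in C^1([a,b]\times \mathbb{R}^{2n}\times \mathbb{R};\mathbb{R})$, written $L(t,x,\dot x,z)$ with $x,\dot x\in\mathbb{R}^n$ and $z\in\mathbb{R}$, extremize (maximize or minimize) $z(b)$ where $$\dot{z}(t)=L(t,x(t),\dot{x}(t),z(t)),\quad t\in[a,b],\qquad x(a)=\alpha,\quad z(a)=\gamma .$$ $PC^1$ denotes piecewise continuously differentiable functions. The final time values $x(b)$ and $z(b)$ are free. Admissible pair: $(x(\cdot),z(\cdot))$ with $x(\cdot) \in PC^1([a,b];\mathbb{R}^n)$ and $z(\cdot) \in PC^1([a,b];\mathbb{R})$ satisfying $\dot{z}(t)=L(t,x(t),\dot{x}(t),z(t))$, $t \in [a,b]$, and the initial conditions $x(a)=\alpha$, $z(a)=\gamma$. Extremizer: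 an admissible pair $(x^*(\cdot),z^*(\cdot))$ is an extremizer to problem $(P_H)$ if $z(b)-z^*(b)$ has the same sign for all admissible pairs $(x(\cdot),z(\cdot))$ that satisfy $\|z-z^* \|_0< \epsilon$ and $\|x-x^* \|_0< \epsilon$ for some positive real $\epsilon$, where $\|y\|_0=\max_{a\leq t \leq b}|y(t)|$. Notation: $\langle x, z \rangle(t):=(t,x(t),\dot{x}(t),z(t))$. The expressions $\frac{\partial L}{\partial x}$, $\frac{\partial L}{\partial \dot x}$ (with values in $\mathbb{R}^n$) and $\frac{\partial L}{\partial z}$ are the partial derivatives of $L$, and $\frac{d}{dt}\left(\frac{\partial L}{\partial \dot{x}}\right)\langle x, z \rangle(t)$ denotes the derivative in $t$ of $t\mapsto \frac{\partial L}{\partial \dot{x}}(t,x(t),\dot{x}(t),z(t))$. *)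

theory Defs
  imports "HOL-Analysis.Analysis"
begin

text \<open>Functions on \<open>[a,b]\<close> are total functions on \<^typ>\<open>real\<close> whose values outside \<open>[a,b]\<close> are
  irrelevant. Hence all derivatives are taken within the interval under consideration; at its
  endpoints they are one-sided. The library predicate \<^const>\<open>C1_differentiable_on\<close> uses two-sided
  derivatives throughout, and \<^const>\<open>piecewise_C1_differentiable_on\<close> does not force the one-sided
  limits of the derivative to exist at the exceptional points.\<close>

definition C1_on :: "real \<Rightarrow> real \<Rightarrow> (real \<Rightarrow> 'v::real_normed_vector) \<Rightarrow> bool" where
  "C1_on c d f \<longleftrightarrow>
     (\<exists>f'. (\<forall>t\<in>{c..d}. (f has_vector_derivative f' t) (at t within {c..d})) \<and>
           continuous_on {c..d} f')"

text \<open>Neighbouring closed pieces share their endpoint, so such a function is continuous.\<close>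

definition PC1 :: "real \<Rightarrow> real \<Rightarrow> (real \<Rightarrow> 'v::real_normed_vector) \<Rightarrow> bool" where
  "PC1 a b f \<longleftrightarrow>
     (\<exists>(m::nat) \<tau>. \<tau> 0 = a \<and> \<tau> m = b \<and>
        (\<forall>i<m. \<tau> i < \<tau> (Suc i) \<and> C1_on (\<tau> i) (\<tau> (Suc i)) f))"

definition C1_lagrangian ::
  "real \<Rightarrow> real \<Rightarrow> (real \<Rightarrow> real^'n \<Rightarrow> real^'n \<Rightarrow> real \<Rightarrow> real) \<Rightarrow> bool" where
  "C1_lagrangian a b L \<longleftrightarrow>
     (\<exists>L' :: real \<times> (real^'n) \<times> (real^'n) \<times> real \<Rightarrow> (real \<times> (real^'n) \<times> (real^'n) \<times> real) \<Rightarrow>\<^sub>L real.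
        (\<forall>p \<in> {a..b} \<times> UNIV.
           ((\<lambda>(t, x, v, z). L t x v z) has_derivative blinfun_apply (L' p))
             (at p within {a..b} \<times> UNIV)) \<and>
        continuous_on ({a..b} \<times> UNIV) L')"

definition dL_dx ::
  "(real \<Rightarrow> real^'n \<Rightarrow> real^'n \<Rightarrow> real \<Rightarrow> real) \<Rightarrow> real \<Rightarrow> real^'n \<Rightarrow> real^'n \<Rightarrow> real \<Rightarrow> real^'n" where
  "dL_dx L t x v z = (\<chi> i. deriv (\<lambda>h. L t (x + h *\<^sub>R axis i 1) v z) 0)"

definition dL_dv ::
  "(real \<Rightarrow> real^'n \<Rightarrow> real^'n \<Rightarrow> real \<Rightarrow> real) \<Rightarrow> real \<Rightarrow> real^'n \<Rightarrow> real^'n \<Rightarrow> real \<Rightarrow> real^'n" where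
  "dL_dv L t x v z = (\<chi> i. deriv (\<lambda>h. L t x (v + h *\<^sub>R axis i 1) z) 0)"

definition dL_dz ::
  "(real \<Rightarrow> real^'n \<Rightarrow> real^'n \<Rightarrow> real \<Rightarrow> real) \<Rightarrow> real \<Rightarrow> real^'n \<Rightarrow> real^'n \<Rightarrow> real \<Rightarrow> real" where
  "dL_dz L t x v z = deriv (\<lambda>w. L t x v w) z"

text \<open>\<open>along I F x z t\<close> is \<open>F(t, x(t), x'(t), z(t))\<close>, with \<open>x'\<close> the derivative of \<open>x\<close> within the
  interval \<open>I\<close>.\<close>

definition along ::
  "real set \<Rightarrow> (real \<Rightarrow> 'v \<Rightarrow> 'v \<Rightarrow> real \<Rightarrow> 'w) \<Rightarrow> (real \<Rightarrow> 'v::real_normed_vector) \<Rightarrow> (real \<Rightarrow> real)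
    \<Rightarrow> real \<Rightarrow> 'w" where
  "along I F x z t = F t (x t) (vector_derivative x (at t within I)) (z t)"

text \<open>An equation between derivatives of piecewise \<open>C\<^sup>1\<close> functions, stated for all \<open>t \<in> [a,b]\<close>, is
  required on every smooth arc \<open>[c,d]\<close>, endpoints included. For a point of \<open>(a,b)\<close> that is not a
  corner, taking an arc with that point in its interior gives the equation with ordinary
  derivatives; at \<open>a\<close>, at \<open>b\<close> and at corners it gives the equation with one-sided derivatives
  (both of them at a corner).\<close>

definition smooth_arc ::
  "real \<Rightarrow> real \<Rightarrow> (real \<Rightarrow> 'v::real_normed_vector) \<Rightarrow> (real \<Rightarrow> real) \<Rightarrow> real \<Rightarrow> real \<Rightarrow> bool" where
  "smooth_arc a b x z c d \<longleftrightarrow> a \<le> c \<and> c < d \<and> d \<le> b \<and> C1_on c d x \<and> C1_on c d z"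

definition admissible ::
  "real \<Rightarrow> real \<Rightarrow> (real \<Rightarrow> real^'n \<Rightarrow> real^'n \<Rightarrow> real \<Rightarrow> real) \<Rightarrow> real^'n \<Rightarrow> real
    \<Rightarrow> (real \<Rightarrow> real^'n) \<Rightarrow> (real \<Rightarrow> real) \<Rightarrow> bool" where
  "admissible a b L \<alpha> \<gamma> x z \<longleftrightarrow>
     PC1 a b x \<and> PC1 a b z \<and>
     (\<forall>c d. smooth_arc a b x z c d \<longrightarrow>
        (\<forall>t\<in>{c..d}. (z has_vector_derivative along {c..d} L x z t) (at t within {c..d}))) \<and>
     x a = \<alpha> \<and> z a = \<gamma>"

definition norm0 :: "real \<Rightarrow> real \<Rightarrow> (real \<Rightarrow> 'v::real_normed_vector) \<Rightarrow> real" where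
  "norm0 a b y = (SUP t\<in>{a..b}. norm (y t))"

text \<open>``Same sign'' is meant in the weak sense: the difference vanishes for the pair
  \<open>(xs, zs)\<close> itself. The two alternatives are minimizers and maximizers.\<close>

definition extremizer ::
  "real \<Rightarrow> real \<Rightarrow> (real \<Rightarrow> real^'n \<Rightarrow> real^'n \<Rightarrow> real \<Rightarrow> real) \<Rightarrow> real^'n \<Rightarrow> real
    \<Rightarrow> (real \<Rightarrow> real^'n) \<Rightarrow> (real \<Rightarrow> real) \<Rightarrow> bool" where
  "extremizer a b L \<alpha> \<gamma> xs zs \<longleftrightarrow>
     admissible a b L \<alpha> \<gamma> xs zs \<and>
     (\<exists>\<epsilon>>0.
        (\<forall>x z. admissible a b L \<alpha> \<gamma> x z \<and> norm0 a b (\<lambda>t. z t - zs t) < \<epsilon> \<and>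
               norm0 a b (\<lambda>t. x t - xs t) < \<epsilon> \<longrightarrow> z b - zs b \<ge> 0) \<or>
        (\<forall>x z. admissible a b L \<alpha> \<gamma> x z \<and> norm0 a b (\<lambda>t. z t - zs t) < \<epsilon> \<and>
               norm0 a b (\<lambda>t. x t - xs t) < \<epsilon> \<longrightarrow> z b - zs b \<le> 0))"

end

theory Submission
  imports Defs
begin

text \<open>Vary \<open>x\<close> to \<open>x + s \<eta>\<close> with \<open>\<eta>(a) = 0\<close>. The Herglotz equation then has a solution \<open>z + e\<^sub>s\<close>
  close to \<open>z\<close>, and \<open>\<theta> = de\<^sub>s/ds\<close> at \<open>s = 0\<close> satisfies the linear equation
  \<open>\<theta>' = L\<^sub>x \<eta> + L\<^sub>v \<eta>' + L\<^sub>z \<theta>\<close>. With the integrating factor \<open>\<lambda> = exp (- \<integral> L\<^sub>z)\<close>, extremality gives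
  \<open>\<lambda>(b) \<theta>(b) = \<integral> \<lambda> (L\<^sub>x \<eta> + L\<^sub>v \<eta>') = 0\<close>. Let \<open>P(t)\<close> be the integral of \<open>\<lambda> L\<^sub>x\<close> from \<open>t\<close> to \<open>b\<close>;
  integrating by parts, the choice \<open>\<eta>' = \<lambda> L\<^sub>v + P\<close> turns this into \<open>\<integral> |\<eta>'|\<^sup>2 = 0\<close>. Hence
  \<open>\<lambda> L\<^sub>v = - P\<close>, whose derivative is the Euler--Lagrange equation and whose value at \<open>b\<close> is the
  transversality condition.\<close>

subsection \<open>Solutions of perturbed differential equations\<close>

text \<open>Two obstacles shape the proof. First, \<open>L\<close> is only C1, so the perturbed
  right-hand side need not be globally Lipschitz in z and a solution might escape before b. The
  deviation is therefore obtained from a truncated equation, with a bound of order s that makes the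
  truncation invisible for small s. The same bound yields differentiability in s at 0, the only
  smoothness in the parameter that is used. Second, x' jumps at corners, so the partial derivatives
  along the extremizer have two values there. Every integrand is indexed by a piece of a partition,
  while \<lambda>, P and \<eta> are antiderivatives glued continuously across corners. The
  integration by parts has to act on the term with L_x: along an arc L_v is known to be continuous
  only, and its differentiability is part of the conclusion. Since x(b) is free, \<eta>(b) is
  unconstrained. Hence P may be normalised by P(b) = 0, the boundary term disappears, and no
  additive constant as in the du Bois-Reymond lemma remains; transversality comes from this
  normalisation.\<close>

text \<open>A Lipschitz constant valid for all \<open>e\<close> lets one fixed point argument cover
  the whole interval. The bound is linear in \<open>e0\<close> and in \<open>N\<close>, which
  measures how far 0 is from solving the equation; when both are of order s, so is the
  solution.\<close>

lemma picard_lipschitz: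
  fixes G :: "real \<Rightarrow> real \<Rightarrow> real"
  assumes cd: "c \<le> d"
    and cont: "continuous_on ({c..d} \<times> UNIV) (\<lambda>(t, e). G t e)"
    and M: "0 \<le> M"
    and lip: "\<And>t e e'. t \<in> {c..d} \<Longrightarrow> \<bar>G t e - G t e'\<bar> \<le> M * \<bar>e - e'\<bar>"
    and bd: "\<And>t. t \<in> {c..d} \<Longrightarrow> \<bar>G t 0\<bar> \<le> N"
  obtains e where "e c = e0"
    and "\<And>t. t \<in> {c..d} \<Longrightarrow> (e has_real_derivative G t (e t)) (at t within {c..d})"
    and "\<And>t. t \<in> {c..d} \<Longrightarrow> \<bar>e t\<bar> \<le> 2 * exp (2 * M * (d - c)) * (\<bar>e0\<bar> + N * (d - c))"
proof -
  txt \<open>The unknown is \<open>u = e / E\<close>: in the sup norm of \<open>u\<close> the Picard operator has Lipschitz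
    constant \<open>1/2\<close> on the whole interval.\<close>
  define E where "E t = exp (2 * M * (t - c))" for t
  have E_pos: "E t > 0" for t by (simp add: E_def)
  have E_deriv: "(E has_real_derivative 2 * M * E t) (at t within S)" for t S
    unfolding E_def by (auto intro!: derivative_eq_intros)
  have E_cont: "continuous_on S E" for S
    unfolding E_def by (intro continuous_intros)
  have N: "0 \<le> N" using bd[of c] cd by auto
  define K :: "(real \<Rightarrow>\<^sub>C real) \<Rightarrow> real \<Rightarrow> real" where "K u t = G t (E t * u t)" for u t
  define H where "H u t = (e0 + integral {c..t} (K u)) / E t" for u t
  have K_cont: "continuous_on {c..d} (K u)" for u
  proof -
    have "continuous_on {c..d} ((\<lambda>(t, e). G t e) \<circ> (\<lambda>t. (t, E t * u t)))"
      by (intro continuous_on_compose continuous_intros E_cont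
            continuous_on_subset[OF cont]) auto
    then show ?thesis by (simp add: K_def o_def)
  qed
  have I_deriv: "((\<lambda>t. integral {c..t} (K u)) has_real_derivative K u t) (at t within {c..d})"
    if "t \<in> {c..d}" for u t
    using integral_has_real_derivative[OF K_cont that] .
  have H_cont: "continuous_on (cbox c d) (H u)" for u
    unfolding H_def box_real
    using E_pos I_deriv by (intro continuous_intros E_cont DERIV_continuous_on) (auto simp: less_imp_neq[symmetric] order.strict_implies_not_eq)
  \<comment> \<open>The contraction has to act on a complete space, here the bounded continuous
    functions on the whole line. \<open>clamp\<close> extends \<open>H u\<close> by its endpoint
    values; only [c,d] matters afterwards.\<close>
  have "\<exists>v :: real \<Rightarrow>\<^sub>C real. \<forall>t. v t = H u (clamp c d t)" for u
    by (rule continuous_on_cbox_bcontfunE[OF H_cont[of u]]) metis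
  then obtain T :: "(real \<Rightarrow>\<^sub>C real) \<Rightarrow> (real \<Rightarrow>\<^sub>C real)" where T: "\<And>u t. T u t = H u (clamp c d t)"
    by metis
  have clamp_mem: "clamp c d t \<in> {c..d}" for t :: real
    using clamp_in_interval[of c d t] cd by simp
  \<comment> \<open>The exponent \<open>2 * M\<close> is chosen for this integral: M * E integrates
    to (E - 1) / 2, which is at most E / 2, and dividing by the weight E leaves the contraction
    constant 1/2.\<close>
  have E_int: "((\<lambda>s. M * E s * D) has_integral (E t - 1) / 2 * D) {c..t}" if "t \<in> {c..d}" for t D
  proof -
    have "((\<lambda>s. M * E s * D) has_integral (E t / 2 * D - E c / 2 * D)) {c..t}"
    proof (rule fundamental_theorem_of_calculus)
      show "c \<le> t" using that by simp
      fix s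
      have "((\<lambda>s. E s / 2 * D) has_real_derivative M * E s * D) (at s within {c..t})"
        by (rule derivative_eq_intros E_deriv refl | simp)+
      then show "((\<lambda>s. E s / 2 * D) has_vector_derivative M * E s * D) (at s within {c..t})"
        by (simp add: has_real_derivative_iff_has_vector_derivative)
    qed
    then show ?thesis by (simp add: E_def algebra_simps diff_divide_distrib)
  qed
  have K_int: "K u integrable_on {c..t}" if "t \<in> {c..d}" for u t
    using K_cont[of u] that by (intro integrable_continuous_real continuous_on_subset[OF K_cont[of u]]) auto
  have contr: "dist (T u) (T v) \<le> 1 / 2 * dist u v" for u v
  proof (rule dist_bound)
    fix t0
    define t where "t = clamp c d t0"
    have t: "t \<in> {c..d}" unfolding t_def by (rule clamp_mem)
    have "\<bar>integral {c..t} (K u) - integral {c..t} (K v)\<bar>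
        = norm (integral {c..t} (\<lambda>s. K u s - K v s))"
      using K_int[OF t] by (simp add: Henstock_Kurzweil_Integration.integral_diff)
    also have "\<dots> \<le> integral {c..t} (\<lambda>s. M * E s * dist u v)"
    proof (rule Henstock_Kurzweil_Integration.integral_norm_bound_integral)
      show "(\<lambda>s. K u s - K v s) integrable_on {c..t}" "(\<lambda>s. M * E s * dist u v) integrable_on {c..t}"
        using K_int[OF t] E_int[OF t] by (auto intro: Henstock_Kurzweil_Integration.integrable_diff)
      fix s assume "s \<in> {c..t}"
      then have s: "s \<in> {c..d}" using t by auto
      have "\<bar>K u s - K v s\<bar> \<le> M * \<bar>E s * u s - E s * v s\<bar>"
        unfolding K_def by (rule lip[OF s])
      also have "\<bar>E s * u s - E s * v s\<bar> = E s * dist (u s) (v s)"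
        using E_pos[of s] by (simp add: dist_real_def abs_mult flip: right_diff_distrib)
      also have "M * (E s * dist (u s) (v s)) \<le> M * (E s * dist u v)"
        using dist_bounded[of u s v] M E_pos[of s] by (intro mult_left_mono) auto
      finally show "norm (K u s - K v s) \<le> M * E s * dist u v" by simp
    qed
    also have "\<dots> = (E t - 1) / 2 * dist u v"
      using E_int[OF t] by (rule integral_unique)
    also have "\<dots> \<le> E t / 2 * dist u v"
      by (intro mult_right_mono) auto
    finally have "\<bar>integral {c..t} (K u) - integral {c..t} (K v)\<bar> / E t \<le> 1 / 2 * dist u v"
      using E_pos[of t] by (simp add: field_simps)
    then show "dist (T u t0) (T v t0) \<le> 1 / 2 * dist u v"
      using E_pos[of t] by (simp add: T H_def dist_real_def abs_divide flip: t_def diff_divide_distrib)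
  qed
  have "\<exists>!u. T u = u"
    by (rule banach_fix_type[of "1/2"]) (auto simp: contr[simplified])
  then obtain u where u: "T u = u" by blast
  define e where "e t = E t * u t" for t
  have e_eq: "e t = e0 + integral {c..t} (K u)" if "t \<in> {c..d}" for t
  proof -
    have "u t = H u t" using T[of u t] u that by simp
    then show ?thesis using E_pos[of t] by (simp add: e_def H_def)
  qed
  have "dist (T 0) 0 \<le> \<bar>e0\<bar> + N * (d - c)"
  proof (rule dist_bound)
    fix t0
    define t where "t = clamp c d t0"
    have t: "t \<in> {c..d}" unfolding t_def by (rule clamp_mem)
    have "norm (integral {c..t} (K 0)) \<le> N * (t - c)"
      using t bd K_cont[of 0] by (intro integral_bound continuous_on_subset[OF K_cont[of 0]]) (auto simp: K_def)
    also have "\<dots> \<le> N * (d - c)" using t N by (intro mult_left_mono) auto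
    finally have "\<bar>e0 + integral {c..t} (K 0)\<bar> \<le> \<bar>e0\<bar> + N * (d - c)" by simp
    moreover have "\<bar>x\<bar> / E t \<le> \<bar>x\<bar>" for x
    proof -
      have "1 \<le> E t" using t M by (simp add: E_def)
      then have "\<bar>x\<bar> * 1 \<le> \<bar>x\<bar> * E t" by (intro mult_left_mono) auto
      then show ?thesis using E_pos[of t] by (simp add: divide_le_eq)
    qed
    ultimately show "dist (T 0 t0) ((0 :: real \<Rightarrow>\<^sub>C real) t0) \<le> \<bar>e0\<bar> + N * (d - c)"
      using E_pos[of t] unfolding T H_def t_def[symmetric] by (fastforce simp: abs_divide intro: order_trans)
  qed
  \<comment> \<open>The fixed point bounds itself: its norm is at most half of itself plus the norm
    of \<open>T 0\<close>, hence at most twice the latter. This is the factor 2 of the claim; the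
    exponential is the largest value of the weight \<open>E\<close>.\<close>
  moreover have "dist u 0 \<le> dist (T u) (T 0) + dist (T 0) 0"
    using dist_triangle[of u 0 "T 0"] by (simp add: u)
  ultimately have u_bound: "dist u 0 \<le> 2 * (\<bar>e0\<bar> + N * (d - c))"
    using contr[of u 0] by simp
  show thesis
  proof (rule that)
    show "e c = e0" using e_eq[of c] cd by simp
    fix t assume t: "t \<in> {c..d}"
    have "((\<lambda>t. e0 + integral {c..t} (K u)) has_real_derivative G t (e t)) (at t within {c..d})"
      by (rule derivative_eq_intros I_deriv[OF t] refl | simp add: K_def e_def)+
    then show "(e has_real_derivative G t (e t)) (at t within {c..d})"
      by (rule has_field_derivative_transform_within[OF _ zero_less_one t]) (simp add: e_eq)
    have "\<bar>u t\<bar> \<le> dist u 0" using dist_bounded[of u t 0] by simp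
    then have "\<bar>u t\<bar> \<le> 2 * (\<bar>e0\<bar> + N * (d - c))" using u_bound by simp
    moreover have "E t \<le> exp (2 * M * (d - c))" using t M by (auto simp: E_def intro!: mult_left_mono)
    ultimately have "E t * \<bar>u t\<bar> \<le> exp (2 * M * (d - c)) * (2 * (\<bar>e0\<bar> + N * (d - c)))"
      using E_pos[of t] by (intro mult_mono) auto
    then show "\<bar>e t\<bar> \<le> 2 * exp (2 * M * (d - c)) * (\<bar>e0\<bar> + N * (d - c))"
      using E_pos[of t] by (simp add: e_def abs_mult algebra_simps)
  qed
qed

text \<open>The one-variable mean value theorem along the segment from (s, v) to (s + h, v + k), so
  a single \<sigma> serves both partial derivatives. It turns bounds on \<open>A\<close> and
  \<open>B\<close> into Lipschitz bounds, and their uniform continuity into an estimate of the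
  first-order remainder.\<close>

lemma real_mean_value_pair:
  fixes G A B :: "real \<Rightarrow> real \<Rightarrow> real"
  assumes "\<And>s v. ((\<lambda>(s, v). G s v) has_derivative (\<lambda>(h, k). h * A s v + k * B s v)) (at (s, v))"
  obtains \<sigma> where "0 < \<sigma>" "\<sigma> < 1"
    "G (s + h) (v + k) - G s v = h * A (s + \<sigma> * h) (v + \<sigma> * k) + k * B (s + \<sigma> * h) (v + \<sigma> * k)"
proof -
  define f' where "f' \<sigma> = h * A (s + \<sigma> * h) (v + \<sigma> * k) + k * B (s + \<sigma> * h) (v + \<sigma> * k)" for \<sigma>
  have "((\<lambda>\<sigma>. G (s + \<sigma> * h) (v + \<sigma> * k)) has_real_derivative f' \<sigma>) (at \<sigma>)" for \<sigma>
  proof -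
    have "((\<lambda>\<sigma>. (s + \<sigma> * h, v + \<sigma> * k)) has_derivative (\<lambda>u. (u * h, u * k))) (at \<sigma>)"
      by (auto intro!: derivative_eq_intros)
    from diff_chain_at[OF this assms[of "s + \<sigma> * h" "v + \<sigma> * k"]]
    moreover have "(\<lambda>u. u * h * A (s + \<sigma> * h) (v + \<sigma> * k) + u * k * B (s + \<sigma> * h) (v + \<sigma> * k)) = (*) (f' \<sigma>)"
      by (simp add: fun_eq_iff f'_def algebra_simps)
    ultimately show ?thesis
      by (simp add: o_def has_field_derivative_def)
  qed
  then obtain \<sigma> where "0 < \<sigma>" "\<sigma> < 1"
    "G (s + 1 * h) (v + 1 * k) - G (s + 0 * h) (v + 0 * k) = (1 - 0) * f' \<sigma>"
    using MVT2[of 0 1 "\<lambda>\<sigma>. G (s + \<sigma> * h) (v + \<sigma> * k)" f'] by auto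
  then show thesis
    using that[of \<sigma>] by (simp add: f'_def)
qed

text \<open>Here \<open>e\<close> is the deviation from the unperturbed solution, \<open>lam\<close> the integrating factor of the
  linearised equation, and \<open>J / lam\<close> its solution.\<close>

lemma variation_on_piece:
  fixes G A B :: "real \<Rightarrow> real \<Rightarrow> real \<Rightarrow> real" and lam J w :: "real \<Rightarrow> real"
  assumes cd: "c < d"
    and contG: "continuous_on ({c..d} \<times> UNIV) (\<lambda>(t, s, v). G t s v)"
    and contA: "continuous_on ({c..d} \<times> UNIV) (\<lambda>(t, s, v). A t s v)"
    and contB: "continuous_on ({c..d} \<times> UNIV) (\<lambda>(t, s, v). B t s v)"
    and deriv: "\<And>t s v. t \<in> {c..d} \<Longrightarrow>
        ((\<lambda>(s, v). G t s v) has_derivative (\<lambda>(h, k). h * A t s v + k * B t s v)) (at (s, v))"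
    and G0: "\<And>t. t \<in> {c..d} \<Longrightarrow> G t 0 0 = 0"
    and lam: "\<And>t. t \<in> {c..d} \<Longrightarrow> (lam has_real_derivative - lam t * B t 0 0) (at t within {c..d})"
    and lam_pos: "\<And>t. t \<in> {c..d} \<Longrightarrow> lam t > 0"
    and J: "\<And>t. t \<in> {c..d} \<Longrightarrow> (J has_real_derivative lam t * A t 0 0) (at t within {c..d})"
    and w0: "w 0 = 0"
    and w: "(w has_real_derivative J c / lam c) (at 0)"
  obtains e :: "real \<Rightarrow> real \<Rightarrow> real" where "\<forall>t. e 0 t = 0"
    and "\<forall>\<^sub>F s in nhds 0. e s c = w s \<and>
           (\<forall>t\<in>{c..d}. (e s has_real_derivative G t s (e s t)) (at t within {c..d}))"
    and "\<forall>\<epsilon>>0. \<forall>\<^sub>F s in nhds 0. \<forall>t\<in>{c..d}. \<bar>e s t\<bar> < \<epsilon>"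
    and "((\<lambda>s. e s d) has_real_derivative J d / lam d) (at 0)"
proof -
  \<comment> \<open>Only small s and v matter in the end. The radius 1 is an arbitrary choice,
    shared with \<open>clip\<close> below.\<close>
  define Q :: "(real \<times> real \<times> real) set" where "Q = {c..d} \<times> {-1..1} \<times> {-1..1}"
  have Q: "compact Q" unfolding Q_def by (intro compact_Times compact_Icc)
  have QA: "continuous_on Q (\<lambda>(t, s, v). A t s v)" and QB: "continuous_on Q (\<lambda>(t, s, v). B t s v)"
    by (auto simp: Q_def intro: continuous_on_subset[OF contA] continuous_on_subset[OF contB])
  obtain MA where MA: "\<And>p. p \<in> Q \<Longrightarrow> norm ((\<lambda>(t, s, v). A t s v) p) \<le> MA"
    using compact_imp_bounded[OF compact_continuous_image[OF QA Q]] unfolding bounded_iff by blast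
  obtain MB where MB: "\<And>p. p \<in> Q \<Longrightarrow> norm ((\<lambda>(t, s, v). B t s v) p) \<le> MB"
    using compact_imp_bounded[OF compact_continuous_image[OF QB Q]] unfolding bounded_iff by blast
  define M where "M = max MA MB"
  have boundA: "\<bar>A t s v\<bar> \<le> M" and boundB: "\<bar>B t s v\<bar> \<le> M"
    if "t \<in> {c..d}" "\<bar>s\<bar> \<le> 1" "\<bar>v\<bar> \<le> 1" for t s v
    using MA[of "(t, s, v)"] MB[of "(t, s, v)"] that by (auto simp: Q_def M_def abs_le_iff)
  have M: "0 \<le> M" using boundA[of c 0 0] cd by auto
  txt \<open>Truncating \<open>v\<close> makes \<open>G\<close> globally Lipschitz; the bound on \<open>e\<close> shows afterwards that the
    truncation is inactive for small \<open>s\<close>.\<close>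
  define clip :: "real \<Rightarrow> real" where "clip v = max (-1) (min 1 v)" for v
  have clip: "\<bar>clip v\<bar> \<le> 1" "\<bar>clip u - clip v\<bar> \<le> \<bar>u - v\<bar>" for u v
    by (auto simp: clip_def max_def min_def)
  have clip_id: "clip v = v" if "\<bar>v\<bar> \<le> 1" for v
    using that by (auto simp: clip_def)
  have clip_cont: "continuous_on S clip" for S
    unfolding clip_def by (intro continuous_intros)
  have conv: "\<bar>u + \<sigma> * (v - u)\<bar> \<le> 1" if "\<bar>u\<bar> \<le> 1" "\<bar>v\<bar> \<le> 1" "0 < \<sigma>" "\<sigma> < 1" for u v \<sigma> :: real
  proof -
    have "\<bar>(1 - \<sigma>) * u + \<sigma> * v\<bar> \<le> (1 - \<sigma>) * 1 + \<sigma> * 1"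
      using that by (intro order_trans[OF abs_triangle_ineq] add_mono) (auto simp: abs_mult mult_left_le)
    then show ?thesis by (simp add: algebra_simps)
  qed
  define C1 where "C1 = 2 * exp (2 * M * (d - c))"
  \<comment> \<open>At v = 0 the right-hand side is at most M times the absolute value of s, because
    \<open>G t 0 0 = 0\<close> and \<open>A\<close> controls the change in s. This plays the role of
    \<open>N\<close>, so the solution is of order s as soon as \<open>w s\<close> is.\<close>
  have sol: "\<exists>e. e c = w s \<and>
      (\<forall>t\<in>{c..d}. (e has_real_derivative G t s (clip (e t))) (at t within {c..d})) \<and>
      (\<forall>t\<in>{c..d}. \<bar>e t\<bar> \<le> C1 * (\<bar>w s\<bar> + M * \<bar>s\<bar> * (d - c)))" if s: "\<bar>s\<bar> \<le> 1" for s
  proof (rule picard_lipschitz[of c d "\<lambda>t v. G t s (clip v)" M "M * \<bar>s\<bar>" "w s"])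
    show "continuous_on ({c..d} \<times> UNIV) (\<lambda>(t, v). G t s (clip v))"
    proof -
      have "continuous_on ({c..d} \<times> UNIV) ((\<lambda>(t, s, v). G t s v) \<circ> (\<lambda>(t, v). (t, s, clip v)))"
        by (intro continuous_on_compose continuous_on_subset[OF contG])
          (auto simp: split_beta intro!: continuous_intros continuous_on_compose2[OF clip_cont[of UNIV]])
      then show ?thesis by (simp add: o_def split_beta)
    qed
    show "\<bar>G t s (clip v) - G t s (clip v')\<bar> \<le> M * \<bar>v - v'\<bar>" if t: "t \<in> {c..d}" for t v v'
    proof -
      obtain \<sigma> where \<sigma>: "0 < \<sigma>" "\<sigma> < 1" and
        eq: "G t (s + 0) (clip v' + (clip v - clip v')) - G t s (clip v')
         = 0 * A t (s + \<sigma> * 0) (clip v' + \<sigma> * (clip v - clip v'))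
           + (clip v - clip v') * B t (s + \<sigma> * 0) (clip v' + \<sigma> * (clip v - clip v'))"
        by (rule real_mean_value_pair[OF deriv[OF t]])
      have "\<bar>G t s (clip v) - G t s (clip v')\<bar>
          = \<bar>clip v - clip v'\<bar> * \<bar>B t s (clip v' + \<sigma> * (clip v - clip v'))\<bar>"
        using eq by (simp add: abs_mult)
      also have "\<dots> \<le> \<bar>v - v'\<bar> * M"
        by (intro mult_mono clip boundB t s conv \<sigma>) auto
      finally show ?thesis by (simp add: mult.commute)
    qed
    show "\<bar>G t s (clip 0)\<bar> \<le> M * \<bar>s\<bar>" if t: "t \<in> {c..d}" for t
    proof -
      obtain \<sigma> where \<sigma>: "0 < \<sigma>" "\<sigma> < 1" and
        eq: "G t (0 + s) (0 + 0) - G t 0 0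
         = s * A t (0 + \<sigma> * s) (0 + \<sigma> * 0) + 0 * B t (0 + \<sigma> * s) (0 + \<sigma> * 0)"
        by (rule real_mean_value_pair[OF deriv[OF t]])
      have "\<bar>G t s 0\<bar> = \<bar>s\<bar> * \<bar>A t (\<sigma> * s) 0\<bar>"
        using eq G0[OF t] by (simp add: abs_mult)
      also have "\<dots> \<le> \<bar>s\<bar> * M"
        using conv[of 0 s \<sigma>] s \<sigma> by (intro mult_left_mono boundA t) auto
      finally show ?thesis using clip_id[of 0] by (simp add: mult.commute)
    qed
  qed (use cd M C1_def in auto)
  obtain e0 where e0: "\<And>s. \<bar>s\<bar> \<le> 1 \<Longrightarrow> e0 s c = w s"
    "\<And>s t. \<bar>s\<bar> \<le> 1 \<Longrightarrow> t \<in> {c..d} \<Longrightarrow> (e0 s has_real_derivative G t s (clip (e0 s t))) (at t within {c..d})"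
    "\<And>s t. \<bar>s\<bar> \<le> 1 \<Longrightarrow> t \<in> {c..d} \<Longrightarrow> \<bar>e0 s t\<bar> \<le> C1 * (\<bar>w s\<bar> + M * \<bar>s\<bar> * (d - c))"
    using sol by metis
  \<comment> \<open>On [c,d] the bound already forces \<open>e0 0\<close> to vanish, since
    \<open>w 0 = 0\<close>; outside, its values are arbitrary. Redefining it makes the unperturbed
    deviation zero everywhere.\<close>
  define e where "e s = (if s = 0 then (\<lambda>t. 0) else e0 s)" for s
  \<comment> \<open>Any number above the absolute value of w'(0) would serve; the strict inequality
    passes to the difference quotients near 0.\<close>
  define W where "W = \<bar>J c / lam c\<bar> + 1"
  have w_quot: "((\<lambda>s. w s / s) \<longlongrightarrow> J c / lam c) (at 0)"
    using w w0 by (simp add: has_field_derivative_iff)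
  have "\<forall>\<^sub>F s in at 0. \<bar>w s / s\<bar> < W"
    by (rule order_tendstoD(2)[OF tendsto_rabs[OF w_quot]]) (simp add: W_def)
  then have w_bound: "\<forall>\<^sub>F s in at 0. \<bar>w s\<bar> \<le> W * \<bar>s\<bar>"
    using eventually_neq_at_within[of 0]
    by eventually_elim (auto simp: abs_divide field_simps)
  define C where "C = C1 * (W + M * (d - c))"
  have C1: "C1 \<ge> 0" by (simp add: C1_def)
  have C: "C \<ge> 0" using C1 M cd by (auto simp: C_def W_def)
  have small: "\<forall>\<^sub>F s in at (0 :: real). \<bar>s\<bar> < \<epsilon>" if "\<epsilon> > 0" for \<epsilon>
    using order_tendstoD(2)[OF tendsto_rabs[OF tendsto_ident_at[of 0 UNIV]], of \<epsilon>] that by simp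
  have e_bound: "\<forall>\<^sub>F s in at 0. \<forall>t\<in>{c..d}. \<bar>e s t\<bar> \<le> C * \<bar>s\<bar>"
    using w_bound small[OF zero_less_one] eventually_neq_at_within[of 0]
  proof eventually_elim
    case (elim s)
    show ?case
    proof
      fix t assume t: "t \<in> {c..d}"
      have "\<bar>e s t\<bar> \<le> C1 * (\<bar>w s\<bar> + M * \<bar>s\<bar> * (d - c))"
        using e0(3)[OF _ t, of s] elim by (simp add: e_def)
      also have "\<dots> \<le> C1 * (W * \<bar>s\<bar> + M * \<bar>s\<bar> * (d - c))"
        using elim C1 by (intro mult_left_mono add_right_mono) auto
      finally show "\<bar>e s t\<bar> \<le> C * \<bar>s\<bar>" by (simp add: C_def algebra_simps)
    qed
  qed
  have e_small: "\<forall>\<^sub>F s in at 0. \<forall>t\<in>{c..d}. \<bar>e s t\<bar> < \<epsilon>" if "\<epsilon> > 0" for \<epsilon>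
  proof -
    have "\<epsilon> / (C + 1) > 0" using that C by simp
    from small[OF this] e_bound show ?thesis
    proof eventually_elim
      case (elim s)
      have "C * \<bar>s\<bar> \<le> (C + 1) * \<bar>s\<bar>" by (simp add: mult_right_mono)
      also have "\<dots> < \<epsilon>" using elim C by (simp add: field_simps)
      finally show ?case using elim by force
    qed
  qed
  have e_ode: "\<forall>\<^sub>F s in at 0. e s c = w s \<and>
           (\<forall>t\<in>{c..d}. (e s has_real_derivative G t s (e s t)) (at t within {c..d}))"
    using e_small[OF zero_less_one] small[OF zero_less_one] eventually_neq_at_within[of 0]
  proof eventually_elim
    case (elim s)
    have "(e s has_real_derivative G t s (e s t)) (at t within {c..d})" if "t \<in> {c..d}" for t
      using e0(2)[of s t] clip_id[of "e s t"] elim that by (simp add: e_def less_imp_le)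
    then show ?case using elim e0(1)[of s] by (simp add: e_def)
  qed
  \<comment> \<open>The first-order remainder of \<open>e\<close>, multiplied by the integrating
    factor. In its derivative the linear terms cancel, leaving \<open>lam\<close> times the
    first-order Taylor remainder of \<open>G\<close>, which is o(s) uniformly in t.\<close>
  define r where "r s t = lam t * e s t - s * J t" for s t
  have lam_cont: "continuous_on {c..d} lam"
    using lam by (rule DERIV_continuous_on)
  obtain \<Lambda> where \<Lambda>: "\<And>t. t \<in> {c..d} \<Longrightarrow> norm (lam t) \<le> \<Lambda>"
    using compact_imp_bounded[OF compact_continuous_image[OF lam_cont compact_Icc]]
    unfolding bounded_iff by blast
  have \<Lambda>0: "\<Lambda> \<ge> 0" using \<Lambda>[of c] cd by (auto intro: order_trans[OF norm_ge_zero])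
  have r_lim: "((\<lambda>s. (r s d - r s c) / s) \<longlongrightarrow> 0) (at 0)"
  proof (rule tendstoI)
    fix \<epsilon> :: real assume \<epsilon>: "\<epsilon> > 0"
    \<comment> \<open>\<open>X\<close> collects the constants of the estimate: the length of the
      interval, the bound on \<open>lam\<close>, and the factor 1 + C from the sum of the absolute
      values of s and e, which is at most (1 + C) times that of s. Dividing by \<open>X + 1\<close>
      below avoids a zero denominator.\<close>
    define X where "X = (d - c) * \<Lambda> * (1 + C)"
    have X: "X \<ge> 0" using cd \<Lambda>0 C by (simp add: X_def)
    define \<rho> where "\<rho> = \<epsilon> / (X + 1)"
    have \<rho>: "\<rho> > 0" "X * \<rho> < \<epsilon>" using \<epsilon> X by (auto simp: \<rho>_def field_simps)
    have uA: "uniformly_continuous_on Q (\<lambda>(t, s, v). A t s v)"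
      and uB: "uniformly_continuous_on Q (\<lambda>(t, s, v). B t s v)"
      using QA QB Q by (auto intro: compact_uniformly_continuous)
    obtain \<delta>A where \<delta>A: "\<delta>A > 0" "\<And>p q. p \<in> Q \<Longrightarrow> q \<in> Q \<Longrightarrow> dist q p < \<delta>A \<Longrightarrow>
        dist ((\<lambda>(t, s, v). A t s v) q) ((\<lambda>(t, s, v). A t s v) p) < \<rho>"
      using uA \<rho>(1) unfolding uniformly_continuous_on_def by metis
    obtain \<delta>B where \<delta>B: "\<delta>B > 0" "\<And>p q. p \<in> Q \<Longrightarrow> q \<in> Q \<Longrightarrow> dist q p < \<delta>B \<Longrightarrow>
        dist ((\<lambda>(t, s, v). B t s v) q) ((\<lambda>(t, s, v). B t s v) p) < \<rho>"
      using uB \<rho>(1) unfolding uniformly_continuous_on_def by metis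
    \<comment> \<open>The halves are needed because the distance from (t, s, v) to (t, 0, 0) is
      estimated by the sum of two terms below \<delta>; the 1 keeps the point inside
      \<open>Q\<close>.\<close>
    define \<delta> where "\<delta> = min 1 (min (\<delta>A / 2) (\<delta>B / 2))"
    have \<delta>: "\<delta> > 0" using \<delta>A \<delta>B by (simp add: \<delta>_def)
    have close: "\<bar>A t s v - A t 0 0\<bar> \<le> \<rho>" "\<bar>B t s v - B t 0 0\<bar> \<le> \<rho>"
      if "t \<in> {c..d}" "\<bar>s\<bar> < \<delta>" "\<bar>v\<bar> < \<delta>" for t s v
    proof -
      have "dist (t, s, v) (t, 0, 0) \<le> \<bar>s\<bar> + \<bar>v\<bar>"
        by (simp add: dist_Pair_Pair sqrt_sum_squares_le_sum_abs)
      then have "dist (t, s, v) (t, 0, 0) < \<delta>A" "dist (t, s, v) (t, 0, 0) < \<delta>B"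
        using that by (auto simp: \<delta>_def)
      moreover have "(t, s, v) \<in> Q" "(t, 0, 0) \<in> Q"
        using that by (auto simp: Q_def \<delta>_def)
      ultimately show "\<bar>A t s v - A t 0 0\<bar> \<le> \<rho>" "\<bar>B t s v - B t 0 0\<bar> \<le> \<rho>"
        using \<delta>A(2)[of "(t, 0, 0)" "(t, s, v)"] \<delta>B(2)[of "(t, 0, 0)" "(t, s, v)"]
        by (auto simp: dist_real_def)
    qed
    show "\<forall>\<^sub>F s in at 0. dist ((r s d - r s c) / s) 0 < \<epsilon>"
      using e_ode e_bound e_small[OF \<delta>] small[OF \<delta>] eventually_neq_at_within[of 0]
    proof eventually_elim
      case (elim s)
      define r' where "r' t = lam t * (G t s (e s t) - e s t * B t 0 0 - s * A t 0 0)" for t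
      have "(r s has_real_derivative r' t) (at t within {c..d})" if "t \<in> {c..d}" for t
        unfolding r_def r'_def using that elim
        by (auto intro!: derivative_eq_intros lam J simp: algebra_simps)
      moreover have "norm (r' t) \<le> \<Lambda> * (\<rho> * ((1 + C) * \<bar>s\<bar>))" if t: "t \<in> {c..d}" for t
      proof -
        obtain \<sigma> where \<sigma>: "0 < \<sigma>" "\<sigma> < 1" and
          eq: "G t (0 + s) (0 + e s t) - G t 0 0 = s * A t (0 + \<sigma> * s) (0 + \<sigma> * e s t)
             + e s t * B t (0 + \<sigma> * s) (0 + \<sigma> * e s t)"
          by (rule real_mean_value_pair[OF deriv[OF t]])
        have sc: "\<bar>\<sigma> * q\<bar> \<le> \<bar>q\<bar>" for q using \<sigma> by (simp add: abs_mult mult_left_le_one_le)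
        have lt: "\<bar>\<sigma> * s\<bar> < \<delta>" "\<bar>\<sigma> * e s t\<bar> < \<delta>"
          using sc[of s] sc[of "e s t"] elim t by force+
        have "G t s (e s t) - e s t * B t 0 0 - s * A t 0 0
           = s * (A t (\<sigma> * s) (\<sigma> * e s t) - A t 0 0) + e s t * (B t (\<sigma> * s) (\<sigma> * e s t) - B t 0 0)"
          using eq G0[OF t] by (simp add: algebra_simps)
        also have "\<bar>\<dots>\<bar> \<le> \<bar>s\<bar> * \<rho> + \<bar>e s t\<bar> * \<rho>"
          using close[OF t lt]
          by (intro order_trans[OF abs_triangle_ineq] add_mono) (auto simp: abs_mult intro: mult_left_mono)
        also have "\<dots> \<le> \<bar>s\<bar> * \<rho> + (C * \<bar>s\<bar>) * \<rho>"
          using elim t \<rho> by (intro add_mono mult_right_mono) auto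
        finally have "\<bar>G t s (e s t) - e s t * B t 0 0 - s * A t 0 0\<bar> \<le> \<rho> * ((1 + C) * \<bar>s\<bar>)"
          by (simp add: algebra_simps)
        then show ?thesis
          unfolding r'_def real_norm_def abs_mult using \<Lambda>[OF t] \<Lambda>0 by (intro mult_mono) auto
      qed
      ultimately have "norm (r s d - r s c) \<le> \<Lambda> * (\<rho> * ((1 + C) * \<bar>s\<bar>)) * norm (d - c)"
        using cd by (intro field_differentiable_bound[of "{c..d}"]) auto
      also have "\<dots> = X * \<rho> * \<bar>s\<bar>" using cd by (simp add: X_def)
      finally have "\<bar>(r s d - r s c) / s\<bar> \<le> X * \<rho>"
        using elim by (simp add: abs_divide divide_le_eq)
      then show ?case using \<rho> by (simp add: dist_real_def)
    qed
  qed
  \<comment> \<open>The initial remainder is negligible because w'(0) is exactly J c / lam c, the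
    value at c of the solution of the linearised equation.\<close>
  have "((\<lambda>s. r s c / s) \<longlongrightarrow> lam c * (J c / lam c) - J c) (at 0)"
  proof (rule Lim_transform_eventually)
    show "((\<lambda>s. lam c * (w s / s) - J c) \<longlongrightarrow> lam c * (J c / lam c) - J c) (at 0)"
      by (intro tendsto_intros w_quot)
    show "\<forall>\<^sub>F s in at 0. lam c * (w s / s) - J c = r s c / s"
      using e_ode eventually_neq_at_within[of 0]
      by eventually_elim (simp add: r_def diff_divide_distrib)
  qed
  from tendsto_add[OF r_lim this] have lim_d: "((\<lambda>s. r s d / s) \<longlongrightarrow> 0) (at 0)"
    using lam_pos[of c] cd by (simp add: add_divide_distrib diff_divide_distrib)
  have "((\<lambda>s. e s d / s) \<longlongrightarrow> (0 + J d) / lam d) (at 0)"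
  proof (rule Lim_transform_eventually)
    show "((\<lambda>s. (r s d / s + J d) / lam d) \<longlongrightarrow> (0 + J d) / lam d) (at 0)"
      using lam_pos[of d] cd by (intro tendsto_intros lim_d) auto
    show "\<forall>\<^sub>F s in at 0. (r s d / s + J d) / lam d = e s d / s"
      using eventually_neq_at_within[of 0]
      by eventually_elim (use lam_pos[of d] cd in \<open>simp add: r_def field_simps\<close>)
  qed
  then have e_deriv: "((\<lambda>s. e s d) has_real_derivative J d / lam d) (at 0)"
    by (simp add: has_field_derivative_iff e_def)
  show thesis
  proof (rule that)
    show "\<forall>t. e 0 t = 0" by (simp add: e_def)
    \<comment> \<open>The filter \<open>at 0\<close> omits s = 0; checking this value separately
      upgrades the statement to \<open>nhds 0\<close>.\<close>
    have "e 0 c = w 0 \<and> (\<forall>t\<in>{c..d}. (e 0 has_real_derivative G t 0 (e 0 t)) (at t within {c..d}))"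
      using w0 G0 by (simp add: e_def)
    then show "\<forall>\<^sub>F s in nhds 0. e s c = w s \<and>
           (\<forall>t\<in>{c..d}. (e s has_real_derivative G t s (e s t)) (at t within {c..d}))"
      using e_ode by (simp add: eventually_nhds_conv_at)
    show "\<forall>\<epsilon>>0. \<forall>\<^sub>F s in nhds 0. \<forall>t\<in>{c..d}. \<bar>e s t\<bar> < \<epsilon>"
      using e_small by (simp add: eventually_nhds_conv_at e_def)
    show "((\<lambda>s. e s d) has_real_derivative J d / lam d) (at 0)" by (rule e_deriv)
  qed
qed

subsection \<open>Partitions into smooth arcs\<close>

lemma partition_mono:
  fixes \<tau> :: "nat \<Rightarrow> real"
  assumes "\<And>i. i < m \<Longrightarrow> \<tau> i < \<tau> (Suc i)" and "i \<le> j" "j \<le> m"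
  shows "\<tau> i \<le> \<tau> j"
  using assms(2,3)
proof (induction j rule: dec_induct)
  case (step n)
  then show ?case using assms(1)[of n] by simp
qed simp

text \<open>When t is a partition point it lies in two pieces, and one of them may meet [c,d] in t
  alone. Going to the right if t < d and to the left if t = d gives a nondegenerate overlap, so that
  derivatives within both intervals can be compared at t. The strict and the weak inequality in the
  two searches for an index pick the piece on the proper side.\<close>

lemma partition_overlap:
  fixes \<tau> :: "nat \<Rightarrow> real"
  assumes strict: "\<And>i. i < m \<Longrightarrow> \<tau> i < \<tau> (Suc i)"
    and cd: "\<tau> 0 \<le> c" "c < d" "d \<le> \<tau> m" and t: "t \<in> {c..d}"
  obtains i p q where "i < m" "p < q" "t \<in> {p..q}" "{p..q} \<subseteq> {c..d}" "{p..q} \<subseteq> {\<tau> i..\<tau> (Suc i)}"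
proof (cases "t < d")
  case True
  have "\<exists>i<m. (\<forall>j\<le>i. \<not> t < \<tau> j) \<and> t < \<tau> (Suc i)"
    using True cd t by (intro ex_least_nat_less) auto
  then obtain i where i: "i < m" "\<tau> i \<le> t" "t < \<tau> (Suc i)" by auto
  show thesis
    by (rule that[OF i(1), of t "min d (\<tau> (Suc i))"]) (use True i t in auto)
next
  case False
  have "\<exists>i<m. (\<forall>j\<le>i. \<not> t \<le> \<tau> j) \<and> t \<le> \<tau> (Suc i)"
    using False cd t by (intro ex_least_nat_less) auto
  then obtain i where i: "i < m" "\<tau> i < t" "t \<le> \<tau> (Suc i)" by force
  show thesis
    by (rule that[OF i(1), of "max c (\<tau> i)" t]) (use False i t cd in auto)
qed

lemma partition_of_finite_set:
  fixes S :: "real set"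
  assumes S: "finite S" "S \<subseteq> {a..b}" "a \<in> S" "b \<in> S"
  obtains m \<tau> where "\<tau> (0 :: nat) = a" "\<tau> m = b" "S = \<tau> ` {..m}"
    "\<forall>i<m. \<tau> i < \<tau> (Suc i) \<and> {\<tau> i<..<\<tau> (Suc i)} \<inter> S = {}"
proof -
  define l where "l = sorted_list_of_set S"
  define m where "m = length l - 1"
  have l: "set l = S" "sorted_wrt (<) l"
    using S by (auto simp: l_def)
  have "l \<noteq> []" using l S by auto
  then have len: "length l = Suc m" by (simp add: m_def)
  have S_eq: "S = (!) l ` {..m}"
    using l(1) len by (auto simp: set_conv_nth less_Suc_eq_le)
  have less: "l ! i < l ! j" if "i < j" "j \<le> m" for i j
    using l(2) that len by (simp add: sorted_wrt_iff_nth_less)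
  have le: "l ! i \<le> l ! j" if "i \<le> j" "j \<le> m" for i j
    using less[of i j] that by (cases "i = j") auto
  show thesis
  proof (rule that[of "(!) l" m])
    show "l ! 0 = a"
    proof (rule antisym)
      obtain k where "k \<le> m" "l ! k = a" using S(3) S_eq by auto
      then show "l ! 0 \<le> a" using le[of 0 k] by simp
      show "a \<le> l ! 0" using S(2) S_eq by auto
    qed
    show "l ! m = b"
    proof (rule antisym)
      obtain k where "k \<le> m" "l ! k = b" using S(4) S_eq by auto
      then show "b \<le> l ! m" using le[of k m] by simp
      show "l ! m \<le> b" using S(2) S_eq by auto
    qed
    show "S = (!) l ` {..m}" by (rule S_eq)
    show "\<forall>i<m. l ! i < l ! Suc i \<and> {l ! i<..<l ! Suc i} \<inter> S = {}"
    proof (intro allI impI conjI)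
      fix i assume i: "i < m"
      show "l ! i < l ! Suc i" using i by (intro less) auto
      have "\<not> (l ! i < l ! k \<and> l ! k < l ! Suc i)" if "k \<le> m" for k
        using le[of k i] le[of "Suc i" k] that i by (cases "k \<le> i") auto
      then show "{l ! i<..<l ! Suc i} \<inter> S = {}" by (auto simp: S_eq)
    qed
  qed
qed

lemma C1_on_subset:
  assumes "C1_on c d f" "{p..q} \<subseteq> {c..d}"
  shows "C1_on p q f"
  using assms unfolding C1_on_def
  by (meson continuous_on_subset has_vector_derivative_within_subset subsetD)

text \<open>Finite exceptional sets can be united, whereas two partitions cannot be used side by
  side; this is how \<open>x\<close> and \<open>z\<close> obtain a common partition. Only the open
  interval has to avoid the set, because the smooth pieces are closed and may end in exceptional
  points.\<close>

lemma PC1_exceptional_set: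
  assumes "PC1 a b f"
  shows "\<exists>S. finite S \<and>
    (\<forall>c d. a \<le> c \<longrightarrow> c < d \<longrightarrow> d \<le> b \<longrightarrow> {c<..<d} \<inter> S = {} \<longrightarrow> C1_on c d f)"
proof -
  obtain m \<tau> where \<tau>: "\<tau> (0 :: nat) = a" "\<tau> m = b" "\<And>i. i < m \<Longrightarrow> \<tau> i < \<tau> (Suc i)"
    "\<And>i. i < m \<Longrightarrow> C1_on (\<tau> i) (\<tau> (Suc i)) f"
    using assms unfolding PC1_def by auto
  show ?thesis
  proof (intro exI[of _ "\<tau> ` {..m}"] conjI allI impI)
    fix c d assume cd: "a \<le> c" "c < d" "d \<le> b" "{c<..<d} \<inter> \<tau> ` {..m} = {}"
    have "\<exists>i<m. (\<forall>j\<le>i. \<not> c < \<tau> j) \<and> c < \<tau> (Suc i)"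
      using cd \<tau> by (intro ex_least_nat_less) auto
    then obtain i where i: "i < m" "\<tau> i \<le> c" "c < \<tau> (Suc i)" by auto
    then have "d \<le> \<tau> (Suc i)" using cd(4) by force
    then show "C1_on c d f" using i by (intro C1_on_subset[OF \<tau>(4)[OF i(1)]]) auto
  qed simp
qed

text \<open>Supplies a starting arc for the construction of a partition when none is given, as for
  the transversality condition.\<close>

lemma smooth_arc_exists:
  assumes ab: "a < b" and "PC1 a b x" "PC1 a b z"
  obtains d where "smooth_arc a b x z a d"
proof -
  obtain X where X: "finite X"
    "\<forall>c d. a \<le> c \<longrightarrow> c < d \<longrightarrow> d \<le> b \<longrightarrow> {c<..<d} \<inter> X = {} \<longrightarrow> C1_on c d x"
    using PC1_exceptional_set[OF assms(2)] by blast
  obtain Z where Z: "finite Z"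
    "\<forall>c d. a \<le> c \<longrightarrow> c < d \<longrightarrow> d \<le> b \<longrightarrow> {c<..<d} \<inter> Z = {} \<longrightarrow> C1_on c d z"
    using PC1_exceptional_set[OF assms(3)] by blast
  define T where "T = insert b {s \<in> X \<union> Z. a < s}"
  have T: "finite T" "T \<noteq> {}" using X Z by (auto simp: T_def)
  have le: "Min T \<le> s" if "s \<in> T" for s using T that by simp
  have "Min T \<in> T" using T by simp
  then have "a < Min T" using ab by (auto simp: T_def)
  moreover have "Min T \<le> b" by (rule le) (simp add: T_def)
  moreover have "{a<..<Min T} \<inter> X = {}" "{a<..<Min T} \<inter> Z = {}"
    using le by (force simp: T_def)+
  ultimately have "smooth_arc a b x z a (Min T)"
    using X(2) Z(2) by (simp add: smooth_arc_def)
  then show thesis by (rule that)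
qed

text \<open>The Euler-Lagrange equation is claimed on arbitrary smooth arcs. Making the given arc a
  single piece yields the derivative within that very arc, two-sided at its interior points, with
  nothing to patch together afterwards.\<close>

lemma smooth_partition_containing_arc:
  assumes "PC1 a b x" "PC1 a b z" and arc: "smooth_arc a b x z c d"
  obtains m \<tau> where "\<tau> (0 :: nat) = a" "\<tau> m = b"
    "\<And>i. i < m \<Longrightarrow> smooth_arc a b x z (\<tau> i) (\<tau> (Suc i))"
    "\<exists>i<m. \<tau> i = c \<and> \<tau> (Suc i) = d"
proof -
  obtain X where X: "finite X"
    "\<forall>c d. a \<le> c \<longrightarrow> c < d \<longrightarrow> d \<le> b \<longrightarrow> {c<..<d} \<inter> X = {} \<longrightarrow> C1_on c d x"
    using PC1_exceptional_set[OF assms(1)] by blast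
  obtain Z where Z: "finite Z"
    "\<forall>c d. a \<le> c \<longrightarrow> c < d \<longrightarrow> d \<le> b \<longrightarrow> {c<..<d} \<inter> Z = {} \<longrightarrow> C1_on c d z"
    using PC1_exceptional_set[OF assms(2)] by blast
  have cd: "a \<le> c" "c < d" "d \<le> b" "C1_on c d x" "C1_on c d z"
    using arc by (auto simp: smooth_arc_def)
  define S where "S = ((X \<union> Z) \<inter> {a..b} - {c<..<d}) \<union> {a, b, c, d}"
  have S: "finite S" "S \<subseteq> {a..b}" "a \<in> S" "b \<in> S"
    using X(1) Z(1) cd by (auto simp: S_def)
  obtain m \<tau> where \<tau>: "\<tau> (0 :: nat) = a" "\<tau> m = b" "S = \<tau> ` {..m}"
    "\<forall>i<m. \<tau> i < \<tau> (Suc i) \<and> {\<tau> i<..<\<tau> (Suc i)} \<inter> S = {}"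
    by (rule partition_of_finite_set[OF S]) (rule that)
  show thesis
  proof (rule that[OF \<tau>(1,2)])
    fix i assume i: "i < m"
    from \<tau>(4) i have lt: "\<tau> i < \<tau> (Suc i)" and gap: "{\<tau> i<..<\<tau> (Suc i)} \<inter> S = {}" by auto
    have "\<tau> i \<in> S" "\<tau> (Suc i) \<in> S" using \<tau>(3) i by auto
    then have ab: "a \<le> \<tau> i" "\<tau> (Suc i) \<le> b"
      using subsetD[OF S(2)] by auto
    have "c \<notin> {\<tau> i<..<\<tau> (Suc i)}" "d \<notin> {\<tau> i<..<\<tau> (Suc i)}"
      using gap by (auto simp: S_def)
    \<comment> \<open>As \<open>c\<close> and \<open>d\<close> belong to \<open>S\<close>, no piece
      straddles either of them.\<close>
    then consider "c \<le> \<tau> i" "\<tau> (Suc i) \<le> d" | "\<tau> (Suc i) \<le> c \<or> d \<le> \<tau> i"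
      using lt cd(2) by fastforce
    then show "smooth_arc a b x z (\<tau> i) (\<tau> (Suc i))"
    proof cases
      case 1
      then show ?thesis
        using C1_on_subset[OF cd(4), of "\<tau> i" "\<tau> (Suc i)"]
          C1_on_subset[OF cd(5), of "\<tau> i" "\<tau> (Suc i)"] ab lt by (simp add: smooth_arc_def)
    next
      case 2
      have "{\<tau> i<..<\<tau> (Suc i)} \<inter> (X \<union> Z) = {}"
      proof -
        have "s \<in> S" if "s \<in> X \<union> Z" "s \<in> {\<tau> i<..<\<tau> (Suc i)}" for s
          using that 2 ab by (auto simp: S_def)
        then show ?thesis using gap by blast
      qed
      then show ?thesis
        using X(2)[rule_format, of "\<tau> i" "\<tau> (Suc i)"] Z(2)[rule_format, of "\<tau> i" "\<tau> (Suc i)"] ab lt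
        by (auto simp: smooth_arc_def)
    qed
  next
    have "c \<in> S" "d \<in> S" by (auto simp: S_def)
    then obtain i j where ij: "i \<le> m" "c = \<tau> i" "j \<le> m" "d = \<tau> j" using \<tau>(3) by auto
    have "i < j" using partition_mono[of m \<tau> j i] \<tau>(4) ij cd(2) by force
    then have im: "i < m" using ij by simp
    have "\<tau> (Suc i) \<le> d"
      using \<open>i < j\<close> ij \<tau>(4) partition_mono[of m \<tau> "Suc i" j] by simp
    moreover have "\<tau> (Suc i) \<in> S" using im \<tau>(3) by auto
    moreover have "S \<inter> {c<..<d} = {}" using cd by (auto simp: S_def)
    moreover have "c < \<tau> (Suc i)" using ij \<tau>(4) im by simp
    ultimately have "\<not> \<tau> (Suc i) < d" "\<tau> (Suc i) \<le> d" by auto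
    then have "\<tau> (Suc i) = d" by simp
    then show "\<exists>i<m. \<tau> i = c \<and> \<tau> (Suc i) = d" using im ij by auto
  qed
qed

section \<open>Gluing along a partition\<close>

lemma glue_has_vector_derivative_left:
  fixes f g :: "real \<Rightarrow> 'v::real_normed_vector"
  assumes "q \<le> u" "t \<in> {p..q}" "(f has_vector_derivative D) (at t within {p..q})"
  shows "((\<lambda>t. if t \<le> u then f t else g t) has_vector_derivative D) (at t within {p..q})"
  by (rule has_vector_derivative_transform[OF assms(2) _ assms(3)]) (use assms in auto)

lemma glue_has_vector_derivative_right:
  fixes f g :: "real \<Rightarrow> 'v::real_normed_vector"
  assumes "u \<le> p" "t \<in> {p..q}" "(g has_vector_derivative D) (at t within {p..q})" and "f u = g u"
  shows "((\<lambda>t. if t \<le> u then f t else g t) has_vector_derivative D) (at t within {p..q})"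
proof (rule has_vector_derivative_transform[OF assms(2) _ assms(3)])
  fix r assume "r \<in> {p..q}"
  then have "r \<le> u \<Longrightarrow> r = u" using assms(1) by auto
  then show "(if r \<le> u then f r else g r) = g r" using assms(4) by auto
qed

text \<open>The integrands depend on x' and may have different values at a corner from the left and
  from the right, so each piece has its own continuous \<open>f i\<close>. The antiderivative is
  nevertheless one function: each piece starts from the value reached on the previous one.\<close>

lemma piecewise_antiderivative:
  fixes f :: "nat \<Rightarrow> real \<Rightarrow> 'v::banach" and \<tau> :: "nat \<Rightarrow> real"
  assumes strict: "\<And>i. i < m \<Longrightarrow> \<tau> i < \<tau> (Suc i)"
    and cont: "\<And>i. i < m \<Longrightarrow> continuous_on {\<tau> i..\<tau> (Suc i)} (f i)"
  obtains F where "F (\<tau> 0) = 0"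
    "\<And>i t. i < m \<Longrightarrow> t \<in> {\<tau> i..\<tau> (Suc i)} \<Longrightarrow>
       (F has_vector_derivative f i t) (at t within {\<tau> i..\<tau> (Suc i)})"
proof -
  have "k \<le> m \<Longrightarrow> \<exists>F. F (\<tau> 0) = 0 \<and> (\<forall>i<k. \<forall>t\<in>{\<tau> i..\<tau> (Suc i)}.
       (F has_vector_derivative f i t) (at t within {\<tau> i..\<tau> (Suc i)}))" for k
  proof (induction k)
    case 0
    show ?case by (rule exI[of _ "\<lambda>t. 0"]) simp
  next
    case (Suc k)
    then obtain F where F: "F (\<tau> 0) = 0" "\<And>i t. i < k \<Longrightarrow> t \<in> {\<tau> i..\<tau> (Suc i)} \<Longrightarrow>
       (F has_vector_derivative f i t) (at t within {\<tau> i..\<tau> (Suc i)})"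
      by auto
    define H where "H t = F (\<tau> k) + integral {\<tau> k..t} (f k)" for t
    have H: "(H has_vector_derivative f k t) (at t within {\<tau> k..\<tau> (Suc k)})"
      if "t \<in> {\<tau> k..\<tau> (Suc k)}" for t
      unfolding H_def using integral_has_vector_derivative[OF cont that] Suc.prems
      by (auto intro!: derivative_eq_intros)
    have eq: "F (\<tau> k) = H (\<tau> k)" by (simp add: H_def)
    have mono: "\<tau> i \<le> \<tau> j" if "i \<le> j" "j \<le> k" for i j
      using partition_mono[of m \<tau> i j] strict that Suc.prems by simp
    show ?case
    proof (rule exI[of _ "\<lambda>t. if t \<le> \<tau> k then F t else H t"], intro conjI allI impI ballI)
      show "(if \<tau> 0 \<le> \<tau> k then F (\<tau> 0) else H (\<tau> 0)) = 0"
        using mono[of 0 k] F(1) by simp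
      fix i t assume i: "i < Suc k" and t: "t \<in> {\<tau> i..\<tau> (Suc i)}"
      show "((\<lambda>t. if t \<le> \<tau> k then F t else H t) has_vector_derivative f i t)
          (at t within {\<tau> i..\<tau> (Suc i)})"
      proof (cases "i = k")
        case True
        then show ?thesis
          using glue_has_vector_derivative_right[of "\<tau> k" "\<tau> i" t _ H _ F] H t eq by simp
      next
        case False
        then show ?thesis
          using glue_has_vector_derivative_left[OF _ t F(2)[OF _ t]] mono[of "Suc i" k] i by simp
      qed
    qed
  qed
  from this[of m] that show thesis by auto
qed

text \<open>Induction on the number of pieces. The value of the deviation at the end of a piece
  becomes the initial value \<open>w s\<close> on the next; it vanishes at s = 0 and has derivative
  J / lam there, which is exactly what \<open>variation_on_piece\<close> asks of \<open>w\<close>.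
  Thus \<open>lam\<close> and \<open>J\<close> must be single functions across the corners, while
  \<open>G\<close>, \<open>A\<close> and \<open>B\<close> may jump.\<close>

lemma variation_on_partition:
  fixes G A B :: "nat \<Rightarrow> real \<Rightarrow> real \<Rightarrow> real \<Rightarrow> real" and lam J :: "real \<Rightarrow> real" and \<tau> :: "nat \<Rightarrow> real"
  assumes strict: "\<And>i. i < m \<Longrightarrow> \<tau> i < \<tau> (Suc i)"
    and contG: "\<And>i. i < m \<Longrightarrow> continuous_on ({\<tau> i..\<tau> (Suc i)} \<times> UNIV) (\<lambda>(t, s, v). G i t s v)"
    and contA: "\<And>i. i < m \<Longrightarrow> continuous_on ({\<tau> i..\<tau> (Suc i)} \<times> UNIV) (\<lambda>(t, s, v). A i t s v)"
    and contB: "\<And>i. i < m \<Longrightarrow> continuous_on ({\<tau> i..\<tau> (Suc i)} \<times> UNIV) (\<lambda>(t, s, v). B i t s v)"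
    and deriv: "\<And>i t s v. i < m \<Longrightarrow> t \<in> {\<tau> i..\<tau> (Suc i)} \<Longrightarrow>
        ((\<lambda>(s, v). G i t s v) has_derivative (\<lambda>(h, k). h * A i t s v + k * B i t s v)) (at (s, v))"
    and G0: "\<And>i t. i < m \<Longrightarrow> t \<in> {\<tau> i..\<tau> (Suc i)} \<Longrightarrow> G i t 0 0 = 0"
    and lam: "\<And>i t. i < m \<Longrightarrow> t \<in> {\<tau> i..\<tau> (Suc i)} \<Longrightarrow>
        (lam has_real_derivative - lam t * B i t 0 0) (at t within {\<tau> i..\<tau> (Suc i)})"
    and lam_pos: "\<And>t. lam t > 0"
    and J: "\<And>i t. i < m \<Longrightarrow> t \<in> {\<tau> i..\<tau> (Suc i)} \<Longrightarrow>
        (J has_real_derivative lam t * A i t 0 0) (at t within {\<tau> i..\<tau> (Suc i)})"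
    and J0: "J (\<tau> 0) = 0"
  obtains e :: "real \<Rightarrow> real \<Rightarrow> real" where "\<forall>t. e 0 t = 0"
    and "\<forall>\<^sub>F s in nhds 0. e s (\<tau> 0) = 0 \<and> (\<forall>i<m. \<forall>t\<in>{\<tau> i..\<tau> (Suc i)}.
           (e s has_real_derivative G i t s (e s t)) (at t within {\<tau> i..\<tau> (Suc i)}))"
    and "\<forall>\<epsilon>>0. \<forall>\<^sub>F s in nhds 0. \<forall>t\<in>{\<tau> 0..\<tau> m}. \<bar>e s t\<bar> < \<epsilon>"
    and "((\<lambda>s. e s (\<tau> m)) has_real_derivative J (\<tau> m) / lam (\<tau> m)) (at 0)"
proof -
  have "k \<le> m \<Longrightarrow> \<exists>e :: real \<Rightarrow> real \<Rightarrow> real. (\<forall>t. e 0 t = 0) \<and>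
      (\<forall>\<^sub>F s in nhds 0. e s (\<tau> 0) = 0 \<and> (\<forall>i<k. \<forall>t\<in>{\<tau> i..\<tau> (Suc i)}.
           (e s has_real_derivative G i t s (e s t)) (at t within {\<tau> i..\<tau> (Suc i)}))) \<and>
      (\<forall>\<epsilon>>0. \<forall>\<^sub>F s in nhds 0. \<forall>t\<in>{\<tau> 0..\<tau> k}. \<bar>e s t\<bar> < \<epsilon>) \<and>
      ((\<lambda>s. e s (\<tau> k)) has_real_derivative J (\<tau> k) / lam (\<tau> k)) (at 0)" for k
  proof (induction k)
    case 0
    show ?case by (rule exI[of _ "\<lambda>s t. 0"]) (simp add: J0)
  next
    case (Suc k)
    then obtain e :: "real \<Rightarrow> real \<Rightarrow> real" where e0: "\<forall>t. e 0 t = 0"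
      and e_ode: "\<forall>\<^sub>F s in nhds 0. e s (\<tau> 0) = 0 \<and> (\<forall>i<k. \<forall>t\<in>{\<tau> i..\<tau> (Suc i)}.
           (e s has_real_derivative G i t s (e s t)) (at t within {\<tau> i..\<tau> (Suc i)}))"
      and e_small: "\<forall>\<epsilon>>0. \<forall>\<^sub>F s in nhds 0. \<forall>t\<in>{\<tau> 0..\<tau> k}. \<bar>e s t\<bar> < \<epsilon>"
      and e_deriv: "((\<lambda>s. e s (\<tau> k)) has_real_derivative J (\<tau> k) / lam (\<tau> k)) (at 0)"
      by auto
    have k: "k < m" using Suc.prems by simp
    obtain y :: "real \<Rightarrow> real \<Rightarrow> real" where y0: "\<forall>t. y 0 t = 0"
      and y_ode: "\<forall>\<^sub>F s in nhds 0. y s (\<tau> k) = e s (\<tau> k) \<and> (\<forall>t\<in>{\<tau> k..\<tau> (Suc k)}.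
           (y s has_real_derivative G k t s (y s t)) (at t within {\<tau> k..\<tau> (Suc k)}))"
      and y_small: "\<forall>\<epsilon>>0. \<forall>\<^sub>F s in nhds 0. \<forall>t\<in>{\<tau> k..\<tau> (Suc k)}. \<bar>y s t\<bar> < \<epsilon>"
      and y_deriv: "((\<lambda>s. y s (\<tau> (Suc k))) has_real_derivative J (\<tau> (Suc k)) / lam (\<tau> (Suc k))) (at 0)"
    proof (rule variation_on_piece[of "\<tau> k" "\<tau> (Suc k)" "G k" "A k" "B k" lam J "\<lambda>s. e s (\<tau> k)"])
      fix t assume t: "t \<in> {\<tau> k..\<tau> (Suc k)}"
      show "((\<lambda>(s, v). G k t s v) has_derivative (\<lambda>(h, r). h * A k t s v + r * B k t s v)) (at (s, v))" for s v
        by (rule deriv[OF k t])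
      show "G k t 0 0 = 0" by (rule G0[OF k t])
      show "(lam has_real_derivative - lam t * B k t 0 0) (at t within {\<tau> k..\<tau> (Suc k)})"
        by (rule lam[OF k t])
      show "(J has_real_derivative lam t * A k t 0 0) (at t within {\<tau> k..\<tau> (Suc k)})"
        by (rule J[OF k t])
    next
      show "\<tau> k < \<tau> (Suc k)" by (rule strict[OF k])
      show "continuous_on ({\<tau> k..\<tau> (Suc k)} \<times> UNIV) (\<lambda>(t, s, v). G k t s v)" by (rule contG[OF k])
      show "continuous_on ({\<tau> k..\<tau> (Suc k)} \<times> UNIV) (\<lambda>(t, s, v). A k t s v)" by (rule contA[OF k])
      show "continuous_on ({\<tau> k..\<tau> (Suc k)} \<times> UNIV) (\<lambda>(t, s, v). B k t s v)" by (rule contB[OF k])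
      show "lam t > 0" for t by (rule lam_pos)
      show "e 0 (\<tau> k) = 0" using e0 by simp
      show "((\<lambda>s. e s (\<tau> k)) has_real_derivative J (\<tau> k) / lam (\<tau> k)) (at 0)" by (rule e_deriv)
    qed (rule that)
    have mono: "\<tau> i \<le> \<tau> j" if "i \<le> j" "j \<le> Suc k" for i j
      using partition_mono[of m \<tau> i j] strict that k by simp
    define E where "E = (\<lambda>s t. if t \<le> \<tau> k then e s t else y s t)"
    have "\<forall>t. E 0 t = 0" by (simp add: E_def e0 y0)
    moreover have "\<forall>\<^sub>F s in nhds 0. E s (\<tau> 0) = 0 \<and> (\<forall>i<Suc k. \<forall>t\<in>{\<tau> i..\<tau> (Suc i)}.
           (E s has_real_derivative G i t s (E s t)) (at t within {\<tau> i..\<tau> (Suc i)}))"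
      using e_ode y_ode
    proof eventually_elim
      case (elim s)
      then have eq: "e s (\<tau> k) = y s (\<tau> k)" by simp
      have "(E s has_real_derivative G i t s (E s t)) (at t within {\<tau> i..\<tau> (Suc i)})"
        if i: "i < Suc k" and t: "t \<in> {\<tau> i..\<tau> (Suc i)}" for i t
      proof (cases "i = k")
        case True
        have "(y s has_vector_derivative G i t s (y s t)) (at t within {\<tau> i..\<tau> (Suc i)})"
          using elim t unfolding True by (simp flip: has_real_derivative_iff_has_vector_derivative)
        then have "(E s has_vector_derivative G i t s (y s t)) (at t within {\<tau> i..\<tau> (Suc i)})"
          unfolding E_def True
          using t eq by (intro glue_has_vector_derivative_right[of "\<tau> k"]) (auto simp: True)
        moreover have "E s t = y s t" using t eq True by (cases "t = \<tau> k") (simp_all add: E_def)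
        ultimately show ?thesis
          unfolding has_real_derivative_iff_has_vector_derivative by simp
      next
        case False
        then have le: "\<tau> (Suc i) \<le> \<tau> k" using i by (intro mono) auto
        have "(e s has_vector_derivative G i t s (e s t)) (at t within {\<tau> i..\<tau> (Suc i)})"
          using elim t False i by (simp flip: has_real_derivative_iff_has_vector_derivative)
        from glue_has_vector_derivative_left[OF le t this]
        have "(E s has_vector_derivative G i t s (e s t)) (at t within {\<tau> i..\<tau> (Suc i)})"
          unfolding E_def .
        moreover have "E s t = e s t" using t le by (simp add: E_def)
        ultimately show ?thesis
          unfolding has_real_derivative_iff_has_vector_derivative by simp
      qed
      moreover have "E s (\<tau> 0) = 0" using elim mono[of 0 k] by (simp add: E_def)
      ultimately show ?case by blast
    qed
    moreover have "\<forall>\<^sub>F s in nhds 0. \<forall>t\<in>{\<tau> 0..\<tau> (Suc k)}. \<bar>E s t\<bar> < \<epsilon>" if "\<epsilon> > 0" for \<epsilon>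
      using e_small[rule_format, OF that] y_small[rule_format, OF that]
      by eventually_elim (auto simp: E_def)
    moreover have "((\<lambda>s. E s (\<tau> (Suc k))) has_real_derivative J (\<tau> (Suc k)) / lam (\<tau> (Suc k))) (at 0)"
      using y_deriv strict[OF k] by (simp add: E_def)
    ultimately show ?case by blast
  qed
  from this[of m] that show thesis by auto
qed

subsection \<open>The Lagrangian and its partial derivatives\<close>

text \<open>Links the coordinatewise definitions to the total derivative. With t fixed the state (x,
  v, z) ranges over the whole space, so the derivative in the state is unrestricted even at t = a
  and t = b, where the derivative in t is one-sided.\<close>

lemma C1_lagrangian_partials:
  fixes L :: "real \<Rightarrow> real^'n \<Rightarrow> real^'n \<Rightarrow> real \<Rightarrow> real"
  assumes L: "C1_lagrangian a b L"
  shows "continuous_on ({a..b} \<times> UNIV) (\<lambda>(t, x, v, z). L t x v z)"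
    and "continuous_on ({a..b} \<times> UNIV) (\<lambda>(t, x, v, z). dL_dx L t x v z)"
    and "continuous_on ({a..b} \<times> UNIV) (\<lambda>(t, x, v, z). dL_dv L t x v z)"
    and "continuous_on ({a..b} \<times> UNIV) (\<lambda>(t, x, v, z). dL_dz L t x v z)"
    and "t \<in> {a..b} \<Longrightarrow> ((\<lambda>(x, v, z). L t x v z) has_derivative
        (\<lambda>(h, k, r). dL_dx L t x v z \<bullet> h + dL_dv L t x v z \<bullet> k + dL_dz L t x v z * r)) (at (x, v, z))"
proof -
  obtain L' :: "real \<times> (real^'n) \<times> (real^'n) \<times> real \<Rightarrow> (real \<times> (real^'n) \<times> (real^'n) \<times> real) \<Rightarrow>\<^sub>L real"
    where L': "\<And>p. p \<in> {a..b} \<times> UNIV \<Longrightarrow>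
        ((\<lambda>(t, x, v, z). L t x v z) has_derivative blinfun_apply (L' p)) (at p within {a..b} \<times> UNIV)"
      and L'_cont: "continuous_on ({a..b} \<times> UNIV) L'"
    using L unfolding C1_lagrangian_def by blast
  show "continuous_on ({a..b} \<times> UNIV) (\<lambda>(t, x, v, z). L t x v z)"
    using L' by (rule has_derivative_continuous_on)
  \<comment> \<open>Chain rule with the embedding of the slice at t: its image stays inside the
    domain on which \<open>L\<close> is differentiable.\<close>
  have state: "((\<lambda>(x, v, z). L t x v z) has_derivative (\<lambda>(h, k, r). L' (t, x, v, z) (0, h, k, r))) (at (x, v, z))"
    if t: "t \<in> {a..b}" for t x v z
  proof -
    have "(Pair t has_derivative Pair 0) (at (x, v, z))"
      by (auto intro!: derivative_eq_intros)
    moreover have "((\<lambda>(t, x, v, z). L t x v z) has_derivative blinfun_apply (L' (t, x, v, z)))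
        (at (t, x, v, z) within range (Pair t))"
      by (rule has_derivative_subset[OF L']) (use t in auto)
    ultimately have "((\<lambda>(t, x, v, z). L t x v z) \<circ> Pair t has_derivative
        blinfun_apply (L' (t, x, v, z)) \<circ> Pair 0) (at (x, v, z))"
      by (rule diff_chain_within)
    then show ?thesis by (simp add: o_def case_prod_unfold)
  qed
  \<comment> \<open>Choosing the direction as a coordinate axis gives \<open>dL_dx\<close> and
    \<open>dL_dv\<close>, which are derivatives at 0 of increments. \<open>dL_dz\<close> is a
    derivative at z itself and is treated separately.\<close>
  have line: "deriv (\<lambda>s. L t (x + s *\<^sub>R h) (v + s *\<^sub>R k) (z + s * r)) 0 = L' (t, x, v, z) (0, h, k, r)"
    if t: "t \<in> {a..b}" for t x v z h k r
  proof (rule DERIV_imp_deriv)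
    have "((\<lambda>s. (x + s *\<^sub>R h, v + s *\<^sub>R k, z + s * r)) has_derivative (\<lambda>s. (s *\<^sub>R h, s *\<^sub>R k, s * r))) (at 0)"
      by (auto intro!: derivative_eq_intros)
    moreover have "((\<lambda>(x, v, z). L t x v z) has_derivative (\<lambda>(h, k, r). L' (t, x, v, z) (0, h, k, r)))
        (at (x + 0 *\<^sub>R h, v + 0 *\<^sub>R k, z + 0 * r))"
      using state[OF t] by simp
    ultimately have "((\<lambda>(x, v, z). L t x v z) \<circ> (\<lambda>s. (x + s *\<^sub>R h, v + s *\<^sub>R k, z + s * r)) has_derivative
        (\<lambda>(h, k, r). L' (t, x, v, z) (0, h, k, r)) \<circ> (\<lambda>s. (s *\<^sub>R h, s *\<^sub>R k, s * r))) (at 0)"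
      by (rule diff_chain_at)
    moreover have "L' (t, x, v, z) (0, s *\<^sub>R h, s *\<^sub>R k, s * r) = L' (t, x, v, z) (0, h, k, r) * s" for s
      using blinfun.scaleR_right[of "L' (t, x, v, z)" s "(0, h, k, r)"] by (simp add: mult.commute)
    ultimately show "((\<lambda>s. L t (x + s *\<^sub>R h) (v + s *\<^sub>R k) (z + s * r)) has_real_derivative
        L' (t, x, v, z) (0, h, k, r)) (at 0)"
      by (simp add: has_field_derivative_def o_def)
  qed
  have dx: "dL_dx L t x v z = (\<chi> i. L' (t, x, v, z) (0, axis i 1, 0, 0))" if "t \<in> {a..b}" for t x v z
    using line[OF that, where x=x and v=v and z=z and k=0 and r=0 and h="axis i 1" for i]
    by (simp add: dL_dx_def vec_eq_iff)
  have dv: "dL_dv L t x v z = (\<chi> i. L' (t, x, v, z) (0, 0, axis i 1, 0))" if "t \<in> {a..b}" for t x v z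
    using line[OF that, where x=x and v=v and z=z and h=0 and r=0 and k="axis i 1" for i]
    by (simp add: dL_dv_def vec_eq_iff)
  have dz: "dL_dz L t x v z = L' (t, x, v, z) (0, 0, 0, 1)" if "t \<in> {a..b}" for t x v z
  proof -
    have "((\<lambda>w. (x, v, w)) has_derivative (\<lambda>s. (0, 0, s))) (at z)"
      by (auto intro!: derivative_eq_intros)
    moreover have "((\<lambda>(x, v, z). L t x v z) has_derivative (\<lambda>(h, k, r). L' (t, x, v, z) (0, h, k, r))) (at (x, v, z))"
      by (rule state[OF that])
    ultimately have "((\<lambda>(x, v, z). L t x v z) \<circ> (\<lambda>w. (x, v, w)) has_derivative
        (\<lambda>(h, k, r). L' (t, x, v, z) (0, h, k, r)) \<circ> (\<lambda>s. (0, 0, s))) (at z)"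
      by (rule diff_chain_at)
    moreover have "(\<lambda>s. L' (t, x, v, z) (0, 0, 0, s)) = (*) (L' (t, x, v, z) (0, 0, 0, 1))"
    proof
      show "L' (t, x, v, z) (0, 0, 0, s) = L' (t, x, v, z) (0, 0, 0, 1) * s" for s
        using blinfun.scaleR_right[of "L' (t, x, v, z)" s "(0, 0, 0, 1)"] by (simp add: mult.commute)
    qed
    ultimately show ?thesis
      unfolding dL_dz_def by (intro DERIV_imp_deriv) (simp add: has_field_derivative_def o_def)
  qed
  have conts: "continuous_on ({a..b} \<times> UNIV) (\<lambda>p. \<chi> i. L' p (0, axis i 1, 0, 0))"
    "continuous_on ({a..b} \<times> UNIV) (\<lambda>p. \<chi> i. L' p (0, 0, axis i 1, 0))"
    "continuous_on ({a..b} \<times> UNIV) (\<lambda>p. L' p (0, 0, 0, 1))"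
    by (intro continuous_intros L'_cont)+
  show "continuous_on ({a..b} \<times> UNIV) (\<lambda>(t, x, v, z). dL_dx L t x v z)"
    by (rule continuous_on_eq[OF conts(1)]) (auto simp: dx)
  show "continuous_on ({a..b} \<times> UNIV) (\<lambda>(t, x, v, z). dL_dv L t x v z)"
    by (rule continuous_on_eq[OF conts(2)]) (auto simp: dv)
  show "continuous_on ({a..b} \<times> UNIV) (\<lambda>(t, x, v, z). dL_dz L t x v z)"
    by (rule continuous_on_eq[OF conts(3)]) (auto simp: dz)
  assume t: "t \<in> {a..b}"
  have sum_axis: "f h = (\<Sum>i\<in>UNIV. f (axis i 1) * h $ i)"
    if "linear f" for f :: "real^'n \<Rightarrow> real" and h
  proof -
    have "f h = f (\<Sum>i\<in>UNIV. h $ i *\<^sub>R axis i 1)"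
      using basis_expansion[of h] by (simp add: scalar_mult_eq_scaleR)
    also have "\<dots> = (\<Sum>i\<in>UNIV. f (axis i 1) * h $ i)"
      using that by (simp add: linear_sum linear_cmul mult.commute)
    finally show ?thesis .
  qed
  have "L' (t, x, v, z) (0, h, k, r) = dL_dx L t x v z \<bullet> h + dL_dv L t x v z \<bullet> k + dL_dz L t x v z * r" for h k r
  proof -
    have "(0, h, k, r) = (0, h, 0, 0) + (0, 0, k, 0) + r *\<^sub>R (0 :: real, 0 :: real^'n, 0 :: real^'n, 1 :: real)"
      by simp
    then have "L' (t, x, v, z) (0, h, k, r)
       = L' (t, x, v, z) (0, h, 0, 0) + L' (t, x, v, z) (0, 0, k, 0) + r * L' (t, x, v, z) (0, 0, 0, 1)"
      by (simp only: blinfun.add_right blinfun.scaleR_right real_scaleR_def)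
    moreover have "linear (\<lambda>h. L' (t, x, v, z) (0, h, 0, 0))" "linear (\<lambda>k. L' (t, x, v, z) (0, 0, k, 0))"
      using blinfun.add_right[of "L' (t, x, v, z)" "(0, h, 0, 0)" "(0, h', 0, 0)" for h h']
        blinfun.scaleR_right[of "L' (t, x, v, z)" s "(0, h, 0, 0)" for s h]
        blinfun.add_right[of "L' (t, x, v, z)" "(0, 0, k, 0)" "(0, 0, k', 0)" for k k']
        blinfun.scaleR_right[of "L' (t, x, v, z)" s "(0, 0, k, 0)" for s k]
      by (auto intro!: linearI)
    ultimately show ?thesis
      using sum_axis[of "\<lambda>h. L' (t, x, v, z) (0, h, 0, 0)" h] sum_axis[of "\<lambda>k. L' (t, x, v, z) (0, 0, k, 0)" k] t
      by (simp add: dx dv dz inner_vec_def)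
  qed
  then show "((\<lambda>(x, v, z). L t x v z) has_derivative
        (\<lambda>(h, k, r). dL_dx L t x v z \<bullet> h + dL_dv L t x v z \<bullet> k + dL_dz L t x v z * r)) (at (x, v, z))"
    using state[OF t, of x v z] by simp
qed

section \<open>One-sided derivatives and admissibility on a partition\<close>

text \<open>Both derivatives restrict to [p,q], where t is a limit point and the derivative is
  unique. To be combined with the overlap from \<open>partition_overlap\<close>.\<close>

lemma vector_derivative_unique_overlap:
  fixes f :: "real \<Rightarrow> 'v::real_normed_vector"
  assumes "(f has_vector_derivative D) (at t within S)" "(f has_vector_derivative D') (at t within T)"
    and "p < q" "t \<in> {p..q}" "{p..q} \<subseteq> S" "{p..q} \<subseteq> T"
  shows "D = D'"
proof (rule vector_derivative_unique_within)
  show "at t within {p..q} \<noteq> bot"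
    using assms(3,4) by (simp add: islimpt_Icc trivial_limit_within)
  show "(f has_vector_derivative D) (at t within {p..q})" "(f has_vector_derivative D') (at t within {p..q})"
    using has_vector_derivative_within_subset[OF assms(1,5)]
      has_vector_derivative_within_subset[OF assms(2,6)] by auto
qed

lemma C1_on_vector_derivative:
  assumes "C1_on c d f" "c < d"
  shows "\<And>t. t \<in> {c..d} \<Longrightarrow>
      (f has_vector_derivative vector_derivative f (at t within {c..d})) (at t within {c..d})"
    and "continuous_on {c..d} (\<lambda>t. vector_derivative f (at t within {c..d}))"
proof -
  obtain f' where f': "\<And>t. t \<in> {c..d} \<Longrightarrow> (f has_vector_derivative f' t) (at t within {c..d})"
    "continuous_on {c..d} f'"
    using assms(1) unfolding C1_on_def by blast
  have eq: "vector_derivative f (at t within {c..d}) = f' t" if "t \<in> {c..d}" for t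
    using vector_derivative_within_cbox[OF assms(2), of t f "f' t"] f'(1)[OF that] that by simp
  show "(f has_vector_derivative vector_derivative f (at t within {c..d})) (at t within {c..d})"
    if "t \<in> {c..d}" for t
    using f'(1)[OF that] eq[OF that] by simp
  show "continuous_on {c..d} (\<lambda>t. vector_derivative f (at t within {c..d}))"
    using f'(2) by (rule continuous_on_eq) (simp add: eq)
qed

lemma continuous_on_comp_state:
  fixes F :: "real \<Rightarrow> 'u::real_normed_vector \<Rightarrow> 'u \<Rightarrow> real \<Rightarrow> 'w::topological_space"
    and f :: "'p::topological_space \<Rightarrow> real"
  assumes "continuous_on ({a..b} \<times> UNIV) (\<lambda>(t, x, v, z). F t x v z)"
    and "continuous_on S f" "continuous_on S X" "continuous_on S V" "continuous_on S Z"
    and "f ` S \<subseteq> {a..b}"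
  shows "continuous_on S (\<lambda>p. F (f p) (X p) (V p) (Z p))"
proof -
  have "continuous_on S (\<lambda>p. (\<lambda>(t, x, v, z). F t x v z) (f p, X p, V p, Z p))"
    by (rule continuous_on_compose2[OF assms(1)]) (use assms in \<open>auto intro!: continuous_intros\<close>)
  then show ?thesis by simp
qed

text \<open>Admissibility asks for the differential equation on every smooth arc of the pair, and
  such an arc may run across partition points. On an arc the derivatives of \<open>X\<close> and
  \<open>Z\<close> exist anyway; comparing them with those on a piece that overlaps near t
  identifies them.\<close>

lemma admissible_of_partition:
  fixes X :: "real \<Rightarrow> real^'n"
  assumes L_cont: "continuous_on ({a..b} \<times> UNIV) (\<lambda>(t, x, v, z). L t x v z)"
    and strict: "\<And>i. i < m \<Longrightarrow> \<tau> i < \<tau> (Suc i)" and ends: "\<tau> 0 = a" "\<tau> m = b"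
    and X: "\<And>i t. i < m \<Longrightarrow> t \<in> {\<tau> i..\<tau> (Suc i)} \<Longrightarrow>
        (X has_vector_derivative X' i t) (at t within {\<tau> i..\<tau> (Suc i)})"
    and X'_cont: "\<And>i. i < m \<Longrightarrow> continuous_on {\<tau> i..\<tau> (Suc i)} (X' i)"
    and Z: "\<And>i t. i < m \<Longrightarrow> t \<in> {\<tau> i..\<tau> (Suc i)} \<Longrightarrow>
        (Z has_vector_derivative L t (X t) (X' i t) (Z t)) (at t within {\<tau> i..\<tau> (Suc i)})"
    and init: "X a = \<alpha>" "Z a = \<gamma>"
  shows "admissible a b L \<alpha> \<gamma> X Z"
  unfolding admissible_def
proof (intro conjI allI impI ballI init)
  have sub: "{\<tau> i..\<tau> (Suc i)} \<subseteq> {a..b}" if "i < m" for i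
    using partition_mono[of m \<tau> 0 i] partition_mono[of m \<tau> "Suc i" m] strict that ends by auto
  have "C1_on (\<tau> i) (\<tau> (Suc i)) X" if "i < m" for i
    unfolding C1_on_def using X[OF that] X'_cont[OF that] by (intro exI[of _ "X' i"]) auto
  then show "PC1 a b X"
    unfolding PC1_def using strict ends by (intro exI[of _ m] exI[of _ \<tau>]) auto
  have "C1_on (\<tau> i) (\<tau> (Suc i)) Z" if i: "i < m" for i
  proof -
    have "continuous_on {\<tau> i..\<tau> (Suc i)} (\<lambda>t. L t (X t) (X' i t) (Z t))"
      using sub[OF i]
      by (intro continuous_on_comp_state[OF L_cont] X'_cont[OF i] continuous_on_id
          continuous_on_vector_derivative[OF X[OF i]] continuous_on_vector_derivative[OF Z[OF i]]) auto
    then show ?thesis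
      unfolding C1_on_def using Z[OF i] by (intro exI[of _ "\<lambda>t. L t (X t) (X' i t) (Z t)"]) auto
  qed
  then show "PC1 a b Z"
    unfolding PC1_def using strict ends by (intro exI[of _ m] exI[of _ \<tau>]) auto
  fix c d t assume arc: "smooth_arc a b X Z c d" and t: "t \<in> {c..d}"
  have cd: "a \<le> c" "c < d" "d \<le> b" "C1_on c d X" "C1_on c d Z"
    using arc by (auto simp: smooth_arc_def)
  obtain i p q where i: "i < m" and pq: "p < q" "t \<in> {p..q}" "{p..q} \<subseteq> {c..d}" "{p..q} \<subseteq> {\<tau> i..\<tau> (Suc i)}"
    by (rule partition_overlap[of m \<tau> c d t]) (use strict cd(1-3) ends t in auto)
  have ti: "t \<in> {\<tau> i..\<tau> (Suc i)}" using pq by blast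
  have "vector_derivative X (at t within {c..d}) = X' i t"
    by (rule vector_derivative_unique_overlap[OF C1_on_vector_derivative(1)[OF cd(4,2) t] X[OF i ti] pq])
  moreover have "vector_derivative Z (at t within {c..d}) = L t (X t) (X' i t) (Z t)"
    by (rule vector_derivative_unique_overlap[OF C1_on_vector_derivative(1)[OF cd(5,2) t] Z[OF i ti] pq])
  ultimately show "(Z has_vector_derivative along {c..d} L X Z t) (at t within {c..d})"
    using C1_on_vector_derivative(1)[OF cd(5,2) t] by (simp add: along_def)
qed

text \<open>A nondecreasing function with equal end values is constant. This replaces the argument
  that a nonnegative integrand with vanishing integral is zero, and it holds up to the endpoints of
  each piece.\<close>

lemma derivative_zero_of_equal_ends:
  fixes \<Phi> :: "real \<Rightarrow> real"
  assumes strict: "\<And>i. i < m \<Longrightarrow> \<tau> i < \<tau> (Suc i)"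
    and deriv: "\<And>i t. i < m \<Longrightarrow> t \<in> {\<tau> i..\<tau> (Suc i)} \<Longrightarrow>
        (\<Phi> has_vector_derivative \<Phi>' i t) (at t within {\<tau> i..\<tau> (Suc i)})"
    and nonneg: "\<And>i t. i < m \<Longrightarrow> t \<in> {\<tau> i..\<tau> (Suc i)} \<Longrightarrow> \<Phi>' i t \<ge> 0"
    and ends: "\<Phi> (\<tau> 0) = \<Phi> (\<tau> m)"
    and i: "i < m" and t: "t \<in> {\<tau> i..\<tau> (Suc i)}"
  shows "\<Phi>' i t = 0"
proof -
  have mono: "\<Phi> s \<le> \<Phi> s'" if "i < m" "s \<in> {\<tau> i..\<tau> (Suc i)}" "s' \<in> {\<tau> i..\<tau> (Suc i)}" "s \<le> s'" for i s s'
  proof (cases "s = s'")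
    case False
    then have "s < s'" using that by simp
    moreover have "(\<Phi> has_derivative (\<lambda>h. h *\<^sub>R \<Phi>' i r)) (at r within {s..s'})" if "s \<le> r" "r \<le> s'" for r
      using deriv[of i r] that \<open>i < m\<close> \<open>s \<in> _\<close> \<open>s' \<in> _\<close>
      unfolding has_vector_derivative_def[symmetric]
      by (auto intro: has_vector_derivative_within_subset)
    ultimately obtain r where r: "r \<in> {s<..<s'}" "\<Phi> s' - \<Phi> s = (s' - s) *\<^sub>R \<Phi>' i r"
      using mvt_simple[of s s' \<Phi> "\<lambda>r h. h *\<^sub>R \<Phi>' i r"] by blast
    then have "0 \<le> (s' - s) *\<^sub>R \<Phi>' i r"
      using nonneg[of i r] that by (intro scaleR_nonneg_nonneg) auto
    then show ?thesis using r by simp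
  qed simp
  have step: "\<Phi> (\<tau> j) \<le> \<Phi> (\<tau> (Suc j))" if "j < m" for j
    using mono[OF that, of "\<tau> j" "\<tau> (Suc j)"] strict[OF that] by simp
  have up: "\<Phi> (\<tau> j) \<le> \<Phi> (\<tau> k)" if "j \<le> k" "k \<le> m" for j k
    using that
  proof (induction k rule: dec_induct)
    case (step k)
    then show ?case using \<open>\<And>j. j < m \<Longrightarrow> \<Phi> (\<tau> j) \<le> \<Phi> (\<tau> (Suc j))\<close>[of k] by simp
  qed simp
  have const: "\<Phi> s = \<Phi> (\<tau> 0)" if "s \<in> {\<tau> i..\<tau> (Suc i)}" for s
    using up[of 0 i] up[of "Suc i" m] mono[OF i, of "\<tau> i" s] mono[OF i, of s "\<tau> (Suc i)"] that i ends by auto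
  have "((\<lambda>s. \<Phi> (\<tau> 0)) has_vector_derivative \<Phi>' i t) (at t within {\<tau> i..\<tau> (Suc i)})"
    by (rule has_vector_derivative_transform[OF t _ deriv[OF i t]]) (simp add: const)
  then show ?thesis
    by (rule vector_derivative_unique_overlap[OF _ has_vector_derivative_const strict[OF i] t order_refl order_refl])
qed

subsection \<open>The first variation\<close>

text \<open>A supremum preserves only weak bounds, hence the intermediate \<open>B\<close> strictly
  below \<epsilon>.\<close>

lemma norm0_less:
  assumes "a \<le> b" "\<And>t. t \<in> {a..b} \<Longrightarrow> norm (f t) \<le> B" "B < \<epsilon>"
  shows "norm0 a b f < \<epsilon>"
proof -
  have "norm0 a b f \<le> B"
    unfolding norm0_def using assms by (intro cSUP_least) auto
  then show ?thesis using assms(3) by simp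
qed

lemma piecewise_bounded:
  fixes f :: "real \<Rightarrow> 'v::real_normed_vector"
  assumes strict: "\<And>i. i < m \<Longrightarrow> \<tau> i < \<tau> (Suc i)" and ends: "\<tau> 0 = a" "\<tau> m = b" "a < b"
    and cont: "\<And>i. i < m \<Longrightarrow> continuous_on {\<tau> i..\<tau> (Suc i)} f"
  obtains B where "\<And>t. t \<in> {a..b} \<Longrightarrow> norm (f t) \<le> B"
proof -
  have "\<exists>B. \<forall>t\<in>{\<tau> i..\<tau> (Suc i)}. norm (f t) \<le> B" if "i < m" for i
    using compact_imp_bounded[OF compact_continuous_image[OF cont[OF that] compact_Icc]]
    unfolding bounded_iff by blast
  then obtain B where B: "\<And>i t. i < m \<Longrightarrow> t \<in> {\<tau> i..\<tau> (Suc i)} \<Longrightarrow> norm (f t) \<le> B i"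
    by metis
  show thesis
  proof (rule that)
    fix t assume t: "t \<in> {a..b}"
    obtain i p q where i: "i < m" and pq: "p < q" "t \<in> {p..q}" "{p..q} \<subseteq> {a..b}" "{p..q} \<subseteq> {\<tau> i..\<tau> (Suc i)}"
      by (rule partition_overlap[of m \<tau> a b t]) (use strict ends t in auto)
    have "norm (f t) \<le> \<bar>B i\<bar>" using B[OF i, of t] pq by force
    also have "\<dots> \<le> (\<Sum>j<m. \<bar>B j\<bar>)" using i by (intro member_le_sum) auto
    finally show "norm (f t) \<le> (\<Sum>j<m. \<bar>B j\<bar>)" .
  qed
qed

text \<open>Fermat's rule for the map from s to \<open>e s b\<close>, whose derivative at 0 is J b /
  lam b. Competitors exist for small s of both signs, so minimizers and maximizers alike force it to
  vanish. The quotient J / lam is the solution \<theta> of the linearised equation.\<close>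

lemma first_variation_zero:
  fixes L :: "real \<Rightarrow> real^'n \<Rightarrow> real^'n \<Rightarrow> real \<Rightarrow> real"
  assumes ab: "a < b" and L: "C1_lagrangian a b L" and ext: "extremizer a b L \<alpha> \<gamma> x z"
    and ends: "\<tau> (0 :: nat) = a" "\<tau> m = b"
    and arcs: "\<And>i. i < m \<Longrightarrow> smooth_arc a b x z (\<tau> i) (\<tau> (Suc i))"
    and \<eta>: "\<And>i t. i < m \<Longrightarrow> t \<in> {\<tau> i..\<tau> (Suc i)} \<Longrightarrow>
        (\<eta> has_vector_derivative g i t) (at t within {\<tau> i..\<tau> (Suc i)})"
    and g: "\<And>i. i < m \<Longrightarrow> continuous_on {\<tau> i..\<tau> (Suc i)} (g i)"
    and \<eta>0: "\<eta> a = 0"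
    and lam: "\<And>i t. i < m \<Longrightarrow> t \<in> {\<tau> i..\<tau> (Suc i)} \<Longrightarrow>
        (lam has_real_derivative - lam t * along {\<tau> i..\<tau> (Suc i)} (dL_dz L) x z t)
          (at t within {\<tau> i..\<tau> (Suc i)})"
    and lam_pos: "\<And>t. lam t > 0"
    and J: "\<And>i t. i < m \<Longrightarrow> t \<in> {\<tau> i..\<tau> (Suc i)} \<Longrightarrow>
        (J has_real_derivative lam t * (along {\<tau> i..\<tau> (Suc i)} (dL_dx L) x z t \<bullet> \<eta> t
            + along {\<tau> i..\<tau> (Suc i)} (dL_dv L) x z t \<bullet> g i t)) (at t within {\<tau> i..\<tau> (Suc i)})"
    and J0: "J a = 0"
  shows "J b = 0"
proof -
  note partials = C1_lagrangian_partials[OF L]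
  have arc: "\<tau> i < \<tau> (Suc i)" "C1_on (\<tau> i) (\<tau> (Suc i)) x" "C1_on (\<tau> i) (\<tau> (Suc i)) z"
    "{\<tau> i..\<tau> (Suc i)} \<subseteq> {a..b}" if "i < m" for i
    using arcs[OF that] by (auto simp: smooth_arc_def)
  define xd where "xd i t = vector_derivative x (at t within {\<tau> i..\<tau> (Suc i)})" for i t
  have x: "(x has_vector_derivative xd i t) (at t within {\<tau> i..\<tau> (Suc i)})"
    if "i < m" "t \<in> {\<tau> i..\<tau> (Suc i)}" for i t
    unfolding xd_def using C1_on_vector_derivative(1)[OF arc(2,1)] that by blast
  have xd_cont: "continuous_on {\<tau> i..\<tau> (Suc i)} (xd i)" if "i < m" for i
    unfolding xd_def using C1_on_vector_derivative(2)[OF arc(2,1)] that by blast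
  have adm: "admissible a b L \<alpha> \<gamma> x z" using ext by (simp add: extremizer_def)
  have z: "(z has_vector_derivative L t (x t) (xd i t) (z t)) (at t within {\<tau> i..\<tau> (Suc i)})"
    if "i < m" "t \<in> {\<tau> i..\<tau> (Suc i)}" for i t
    using adm arcs[OF that(1)] that(2) unfolding admissible_def along_def xd_def by blast
  define X where "X s t = x t + s *\<^sub>R \<eta> t" for s t
  define V where "V i s t = xd i t + s *\<^sub>R g i t" for i s t
  \<comment> \<open>The right-hand side of the equation for the deviation of the perturbed solution
    from \<open>z\<close>; \<open>A\<close> and \<open>B\<close> are its partial derivatives in s
    and in v.\<close>
  define G where "G i t s v = L t (X s t) (V i s t) (z t + v) - L t (x t) (xd i t) (z t)" for i t s v
  define A where "A i t s v = dL_dx L t (X s t) (V i s t) (z t + v) \<bullet> \<eta> t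
      + dL_dv L t (X s t) (V i s t) (z t + v) \<bullet> g i t" for i t s v
  define B where "B i t s v = dL_dz L t (X s t) (V i s t) (z t + v)" for i t s v
  have lift: "continuous_on (S \<times> (UNIV :: (real \<times> real) set)) (\<lambda>p. f (fst p))"
    if "continuous_on S f" for S :: "real set" and f :: "real \<Rightarrow> 'u::real_normed_vector"
    by (rule continuous_on_compose2[OF that continuous_on_fst[OF continuous_on_id]]) auto
  have state_cont: "continuous_on ({\<tau> i..\<tau> (Suc i)} \<times> (UNIV :: (real \<times> real) set))
      (\<lambda>p. F (fst p) (X (fst (snd p)) (fst p)) (V i (fst (snd p)) (fst p)) (z (fst p) + snd (snd p)))"
    if i: "i < m" and F: "continuous_on ({a..b} \<times> UNIV) (\<lambda>(t, x, v, z). F t x v z)"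
    for i and F :: "real \<Rightarrow> real^'n \<Rightarrow> real^'n \<Rightarrow> real \<Rightarrow> 'w::real_normed_vector"
    unfolding X_def V_def
    by (rule continuous_on_comp_state[OF F])
      (use arc(4)[OF i] in \<open>auto intro!: continuous_intros lift continuous_on_vector_derivative[OF x[OF i]]
        continuous_on_vector_derivative[OF z[OF i]] continuous_on_vector_derivative[OF \<eta>[OF i]]
        xd_cont[OF i] g[OF i]\<close>)
  have base_cont: "continuous_on {\<tau> i..\<tau> (Suc i)} (\<lambda>t. L t (x t) (xd i t) (z t))" if i: "i < m" for i
    by (rule continuous_on_comp_state[OF partials(1)])
      (use arc(4)[OF i] in \<open>auto intro!: continuous_intros continuous_on_vector_derivative[OF x[OF i]]
        continuous_on_vector_derivative[OF z[OF i]] xd_cont[OF i]\<close>)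
  obtain e :: "real \<Rightarrow> real \<Rightarrow> real" where e0: "\<forall>t. e 0 t = 0"
    and e_ode: "\<forall>\<^sub>F s in nhds 0. e s (\<tau> 0) = 0 \<and> (\<forall>i<m. \<forall>t\<in>{\<tau> i..\<tau> (Suc i)}.
           (e s has_real_derivative G i t s (e s t)) (at t within {\<tau> i..\<tau> (Suc i)}))"
    and e_small: "\<forall>\<epsilon>>0. \<forall>\<^sub>F s in nhds 0. \<forall>t\<in>{\<tau> 0..\<tau> m}. \<bar>e s t\<bar> < \<epsilon>"
    and e_deriv: "((\<lambda>s. e s (\<tau> m)) has_real_derivative J (\<tau> m) / lam (\<tau> m)) (at 0)"
  proof (rule variation_on_partition[of m \<tau> G A B lam J])
    fix i assume i: "i < m"
    show "\<tau> i < \<tau> (Suc i)" by (rule arc(1)[OF i])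
    show "continuous_on ({\<tau> i..\<tau> (Suc i)} \<times> UNIV) (\<lambda>(t, s, v). G i t s v)"
      unfolding G_def split_beta
      by (intro continuous_on_diff state_cont[OF i partials(1)] lift[OF base_cont[OF i]])
    show "continuous_on ({\<tau> i..\<tau> (Suc i)} \<times> UNIV) (\<lambda>(t, s, v). A i t s v)"
      unfolding A_def split_beta
      by (intro continuous_on_add continuous_on_inner state_cont[OF i partials(2)] state_cont[OF i partials(3)]
          lift[OF g[OF i]] lift[OF continuous_on_vector_derivative[OF \<eta>[OF i]]])
    show "continuous_on ({\<tau> i..\<tau> (Suc i)} \<times> UNIV) (\<lambda>(t, s, v). B i t s v)"
      unfolding B_def split_beta by (rule state_cont[OF i partials(4)])
    fix t assume t: "t \<in> {\<tau> i..\<tau> (Suc i)}"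
    have tab: "t \<in> {a..b}" using t arc(4)[OF i] by blast
    show "G i t 0 0 = 0" by (simp add: G_def X_def V_def)
    show "(lam has_real_derivative - lam t * B i t 0 0) (at t within {\<tau> i..\<tau> (Suc i)})"
      using lam[OF i t] by (simp add: B_def X_def V_def along_def xd_def)
    show "(J has_real_derivative lam t * A i t 0 0) (at t within {\<tau> i..\<tau> (Suc i)})"
      using J[OF i t] by (simp add: A_def X_def V_def along_def xd_def)
    fix s v
    have "((\<lambda>(s, v). (X s t, V i s t, z t + v)) has_derivative
        (\<lambda>(h, k). (h *\<^sub>R \<eta> t, h *\<^sub>R g i t, k))) (at (s, v))"
      unfolding X_def V_def split_beta by (auto intro!: derivative_eq_intros)
    moreover have "((\<lambda>(x, v, z). L t x v z) has_derivative
        (\<lambda>(h, k, r). dL_dx L t (X s t) (V i s t) (z t + v) \<bullet> h + dL_dv L t (X s t) (V i s t) (z t + v) \<bullet> k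
          + dL_dz L t (X s t) (V i s t) (z t + v) * r)) (at ((\<lambda>(s, v). (X s t, V i s t, z t + v)) (s, v)))"
      using partials(5)[OF tab] by simp
    ultimately have "((\<lambda>(x, v, z). L t x v z) \<circ> (\<lambda>(s, v). (X s t, V i s t, z t + v)) has_derivative
        (\<lambda>(h, k, r). dL_dx L t (X s t) (V i s t) (z t + v) \<bullet> h + dL_dv L t (X s t) (V i s t) (z t + v) \<bullet> k
          + dL_dz L t (X s t) (V i s t) (z t + v) * r) \<circ> (\<lambda>(h, k). (h *\<^sub>R \<eta> t, h *\<^sub>R g i t, k))) (at (s, v))"
      by (rule diff_chain_at)
    then have "((\<lambda>p. L t (X (fst p) t) (V i (fst p) t) (z t + snd p)) has_derivative
        (\<lambda>(h, k). h * A i t s v + k * B i t s v)) (at (s, v))"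
      by (simp add: o_def case_prod_unfold A_def B_def algebra_simps)
    then show "((\<lambda>(s, v). G i t s v) has_derivative (\<lambda>(h, k). h * A i t s v + k * B i t s v)) (at (s, v))"
      unfolding G_def case_prod_unfold by (auto intro!: derivative_eq_intros)
  next
    show "lam t > 0" for t by (rule lam_pos)
    show "J (\<tau> 0) = 0" by (simp add: ends J0)
  qed (rule that)
  define Z where "Z s t = z t + e s t" for s t
  have adm_s: "\<forall>\<^sub>F s in nhds 0. admissible a b L \<alpha> \<gamma> (X s) (Z s)"
    using e_ode
  proof eventually_elim
    case (elim s)
    show ?case
    proof (rule admissible_of_partition[where m = m and \<tau> = \<tau> and X' = "\<lambda>i. V i s"])
      fix i assume i: "i < m"
      show "\<tau> i < \<tau> (Suc i)" by (rule arc(1)[OF i])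
      show "continuous_on {\<tau> i..\<tau> (Suc i)} (V i s)"
        unfolding V_def by (intro continuous_intros xd_cont g i)
      fix t assume t: "t \<in> {\<tau> i..\<tau> (Suc i)}"
      show "(X s has_vector_derivative V i s t) (at t within {\<tau> i..\<tau> (Suc i)})"
        unfolding X_def V_def by (auto intro!: derivative_eq_intros x[OF i t] \<eta>[OF i t])
      have "(e s has_vector_derivative G i t s (e s t)) (at t within {\<tau> i..\<tau> (Suc i)})"
        using elim i t by (simp flip: has_real_derivative_iff_has_vector_derivative)
      \<comment> \<open>The unperturbed term subtracted in \<open>G\<close> cancels against the
        derivative of \<open>z\<close>, which leaves \<open>L\<close> along the perturbed
        pair.\<close>
      from has_vector_derivative_add[OF z[OF i t] this]
      show "(Z s has_vector_derivative L t (X s t) (V i s t) (Z s t)) (at t within {\<tau> i..\<tau> (Suc i)})"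
        by (simp add: Z_def[abs_def] G_def)
    qed (use partials(1) adm elim \<eta>0 ends in \<open>auto simp: X_def Z_def admissible_def\<close>)
  qed
  obtain \<epsilon> where \<epsilon>: "\<epsilon> > 0" and opt:
      "(\<forall>x' z'. admissible a b L \<alpha> \<gamma> x' z' \<and> norm0 a b (\<lambda>t. z' t - z t) < \<epsilon> \<and>
               norm0 a b (\<lambda>t. x' t - x t) < \<epsilon> \<longrightarrow> z' b - z b \<ge> 0) \<or>
       (\<forall>x' z'. admissible a b L \<alpha> \<gamma> x' z' \<and> norm0 a b (\<lambda>t. z' t - z t) < \<epsilon> \<and>
               norm0 a b (\<lambda>t. x' t - x t) < \<epsilon> \<longrightarrow> z' b - z b \<le> 0)"
    using ext unfolding extremizer_def by blast
  obtain K where K: "\<And>t. t \<in> {a..b} \<Longrightarrow> norm (\<eta> t) \<le> K"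
    using piecewise_bounded[OF arc(1) ends ab continuous_on_vector_derivative[OF \<eta>]] by blast
  have K0: "K \<ge> 0" using K[of a] ab by (auto intro: order_trans[OF norm_ge_zero])
  have "\<forall>\<^sub>F s in nhds 0. norm0 a b (\<lambda>t. Z s t - z t) < \<epsilon>"
    using e_small[rule_format, of "\<epsilon> / 2"] \<epsilon>
    by (auto elim!: eventually_mono intro!: norm0_less[where B = "\<epsilon> / 2"] less_imp_le
        simp: Z_def ends ab less_imp_le[OF ab])
  \<comment> \<open>\<open>K + 1\<close> rather than \<open>K\<close>, since \<open>K\<close> is
    zero when \<eta> vanishes and \<open>K = 0\<close> is chosen.\<close>
  moreover have "\<forall>\<^sub>F s in nhds (0 :: real). \<bar>s\<bar> < \<epsilon> / (K + 1)"
    using \<epsilon> K0 by (auto simp: eventually_nhds_metric intro!: exI[of _ "\<epsilon> / (K + 1)"])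
  then have "\<forall>\<^sub>F s in nhds 0. norm0 a b (\<lambda>t. X s t - x t) < \<epsilon>"
  proof eventually_elim
    case (elim s)
    show ?case
    proof (rule norm0_less)
      show "norm (X s t - x t) \<le> \<bar>s\<bar> * K" if "t \<in> {a..b}" for t
        using K[OF that] by (simp add: X_def mult_left_mono)
      have "\<bar>s\<bar> * K \<le> \<bar>s\<bar> * (K + 1)" by (simp add: mult_left_mono)
      also have "\<dots> < \<epsilon>" using elim K0 by (simp add: field_simps)
      finally show "\<bar>s\<bar> * K < \<epsilon>" .
    qed (use ab in simp)
  qed
  ultimately have "\<forall>\<^sub>F s in nhds 0. admissible a b L \<alpha> \<gamma> (X s) (Z s) \<and>
      norm0 a b (\<lambda>t. Z s t - z t) < \<epsilon> \<and> norm0 a b (\<lambda>t. X s t - x t) < \<epsilon>"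
    using adm_s by eventually_elim blast
  then obtain \<delta> where \<delta>: "\<delta> > 0" and near: "\<And>s. \<bar>0 - s\<bar> < \<delta> \<Longrightarrow> admissible a b L \<alpha> \<gamma> (X s) (Z s) \<and>
      norm0 a b (\<lambda>t. Z s t - z t) < \<epsilon> \<and> norm0 a b (\<lambda>t. X s t - x t) < \<epsilon>"
    unfolding eventually_nhds_metric dist_real_def by (auto simp: abs_minus_commute)
  have Zb: "Z s b - z b = e s b" for s by (simp add: Z_def)
  have deriv: "((\<lambda>s. e s b) has_real_derivative J b / lam b) (at 0)"
    using e_deriv by (simp add: ends)
  from opt have "J b / lam b = 0"
  proof
    assume min: "\<forall>x' z'. admissible a b L \<alpha> \<gamma> x' z' \<and> norm0 a b (\<lambda>t. z' t - z t) < \<epsilon> \<and>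
               norm0 a b (\<lambda>t. x' t - x t) < \<epsilon> \<longrightarrow> z' b - z b \<ge> 0"
    have "e s b \<ge> e 0 b" if "\<bar>0 - s\<bar> < \<delta>" for s
      using min[rule_format, OF near[OF that]] e0 Zb[of s] by simp
    then show ?thesis using DERIV_local_min[OF deriv \<delta>] by blast
  next
    assume max: "\<forall>x' z'. admissible a b L \<alpha> \<gamma> x' z' \<and> norm0 a b (\<lambda>t. z' t - z t) < \<epsilon> \<and>
               norm0 a b (\<lambda>t. x' t - x t) < \<epsilon> \<longrightarrow> z' b - z b \<le> 0"
    have "e s b \<le> e 0 b" if "\<bar>0 - s\<bar> < \<delta>" for s
      using max[rule_format, OF near[OF that]] e0 Zb[of s] by simp
    then show ?thesis using DERIV_local_max[OF deriv \<delta>] by blast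
  qed
  then show ?thesis using lam_pos[of b] by simp
qed

section \<open>The Euler-Lagrange equation and transversality\<close>

text \<open>The variation has to be built on all pieces at once, although the claim concerns one of
  them. Differentiability of L_v along the piece is not assumed but read off from the formula
  \<open>Lv_eq\<close>.\<close>

lemma euler_lagrange_on_partition:
  fixes L :: "real \<Rightarrow> real^'n \<Rightarrow> real^'n \<Rightarrow> real \<Rightarrow> real"
  assumes ab: "a < b" and L: "C1_lagrangian a b L" and ext: "extremizer a b L \<alpha> \<gamma> x z"
    and ends: "\<tau> (0 :: nat) = a" "\<tau> m = b"
    and arcs: "\<And>i. i < m \<Longrightarrow> smooth_arc a b x z (\<tau> i) (\<tau> (Suc i))"
    and i: "i < m"
  shows "t \<in> {\<tau> i..\<tau> (Suc i)} \<Longrightarrow> \<exists>D.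
        (along {\<tau> i..\<tau> (Suc i)} (dL_dv L) x z has_vector_derivative D) (at t within {\<tau> i..\<tau> (Suc i)}) \<and>
        along {\<tau> i..\<tau> (Suc i)} (dL_dx L) x z t - D
          + along {\<tau> i..\<tau> (Suc i)} (dL_dz L) x z t *\<^sub>R along {\<tau> i..\<tau> (Suc i)} (dL_dv L) x z t = 0"
    and "\<tau> (Suc i) = b \<Longrightarrow> along {\<tau> i..b} (dL_dv L) x z b = 0"
proof -
  note partials = C1_lagrangian_partials[OF L]
  have arc: "\<tau> i < \<tau> (Suc i)" "C1_on (\<tau> i) (\<tau> (Suc i)) x" "C1_on (\<tau> i) (\<tau> (Suc i)) z"
    "{\<tau> i..\<tau> (Suc i)} \<subseteq> {a..b}" if "i < m" for i
    using arcs[OF that] by (auto simp: smooth_arc_def)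
  define Lx where "Lx i = along {\<tau> i..\<tau> (Suc i)} (dL_dx L) x z" for i
  define Lv where "Lv i = along {\<tau> i..\<tau> (Suc i)} (dL_dv L) x z" for i
  define Lz where "Lz i = along {\<tau> i..\<tau> (Suc i)} (dL_dz L) x z" for i
  have along_cont: "continuous_on {\<tau> i..\<tau> (Suc i)} (along {\<tau> i..\<tau> (Suc i)} F x z)"
    if i: "i < m" and F: "continuous_on ({a..b} \<times> UNIV) (\<lambda>(t, x, v, z). F t x v z)"
    for i and F :: "real \<Rightarrow> real^'n \<Rightarrow> real^'n \<Rightarrow> real \<Rightarrow> 'w::real_normed_vector"
    unfolding along_def
    using arc(4)[OF i]
    by (intro continuous_on_comp_state[OF F] continuous_on_id C1_on_vector_derivative(2)[OF arc(2,1)] i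
        continuous_on_vector_derivative[OF C1_on_vector_derivative(1)[OF arc(2)[OF i] arc(1)[OF i]]]
        continuous_on_vector_derivative[OF C1_on_vector_derivative(1)[OF arc(3)[OF i] arc(1)[OF i]]]) auto
  have Lx_cont: "continuous_on {\<tau> i..\<tau> (Suc i)} (Lx i)"
    and Lv_cont: "continuous_on {\<tau> i..\<tau> (Suc i)} (Lv i)"
    and Lz_cont: "continuous_on {\<tau> i..\<tau> (Suc i)} (Lz i)" if "i < m" for i
    using along_cont[OF that partials(2)] along_cont[OF that partials(3)] along_cont[OF that partials(4)]
    by (simp_all add: Lx_def Lv_def Lz_def)
  obtain \<Lambda> where \<Lambda>: "\<And>i t. i < m \<Longrightarrow> t \<in> {\<tau> i..\<tau> (Suc i)} \<Longrightarrow>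
      (\<Lambda> has_vector_derivative Lz i t) (at t within {\<tau> i..\<tau> (Suc i)})"
    by (rule piecewise_antiderivative[where f = Lz and \<tau> = \<tau> and m = m, OF arc(1) Lz_cont]) (assumption, assumption, rule that)
  define lam where "lam t = exp (- \<Lambda> t)" for t
  have lam: "(lam has_real_derivative - lam t * Lz i t) (at t within {\<tau> i..\<tau> (Suc i)})"
    if "i < m" "t \<in> {\<tau> i..\<tau> (Suc i)}" for i t
  proof -
    have "(\<Lambda> has_real_derivative Lz i t) (at t within {\<tau> i..\<tau> (Suc i)})"
      using \<Lambda>[OF that] by (simp add: has_real_derivative_iff_has_vector_derivative)
    then show ?thesis
      unfolding lam_def[abs_def] by (auto intro!: derivative_eq_intros)
  qed
  have lam_pos: "lam t > 0" for t by (simp add: lam_def)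
  have lam_cont: "continuous_on {\<tau> i..\<tau> (Suc i)} lam" if "i < m" for i
    by (rule DERIV_continuous_on[OF lam[OF that]])
  have lam_Lx_cont: "continuous_on {\<tau> i..\<tau> (Suc i)} (\<lambda>t. - (lam t *\<^sub>R Lx i t))" if "i < m" for i
    by (intro continuous_intros lam_cont Lx_cont that)
  obtain P0 where P0: "\<And>i t. i < m \<Longrightarrow> t \<in> {\<tau> i..\<tau> (Suc i)} \<Longrightarrow>
      (P0 has_vector_derivative - (lam t *\<^sub>R Lx i t)) (at t within {\<tau> i..\<tau> (Suc i)})"
    by (rule piecewise_antiderivative[where f = "\<lambda>i t. - (lam t *\<^sub>R Lx i t)" and \<tau> = \<tau> and m = m,
          OF arc(1) lam_Lx_cont]) (assumption, assumption, rule that)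
  \<comment> \<open>Subtracting the value at b makes the boundary term P \<bullet> \<eta> vanish at
    b; at a it vanishes because \<eta> does.\<close>
  define P where "P t = P0 t - P0 b" for t
  have P: "(P has_vector_derivative - (lam t *\<^sub>R Lx i t)) (at t within {\<tau> i..\<tau> (Suc i)})"
    if "i < m" "t \<in> {\<tau> i..\<tau> (Suc i)}" for i t
    unfolding P_def[abs_def] using P0[OF that] by (auto intro!: derivative_eq_intros)
  have P_cont: "continuous_on {\<tau> i..\<tau> (Suc i)} P" if "i < m" for i
    by (rule continuous_on_vector_derivative[OF P[OF that]])
  define g where "g i t = lam t *\<^sub>R Lv i t + P t" for i t
  have g_cont: "continuous_on {\<tau> i..\<tau> (Suc i)} (g i)" if "i < m" for i
    unfolding g_def[abs_def] by (intro continuous_intros lam_cont Lv_cont P_cont that)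
  obtain \<eta> where \<eta>0: "\<eta> (\<tau> 0) = 0" and \<eta>: "\<And>i t. i < m \<Longrightarrow> t \<in> {\<tau> i..\<tau> (Suc i)} \<Longrightarrow>
      (\<eta> has_vector_derivative g i t) (at t within {\<tau> i..\<tau> (Suc i)})"
    by (rule piecewise_antiderivative[where f = g and \<tau> = \<tau> and m = m, OF arc(1) g_cont]) (assumption, assumption, rule that)
  have \<eta>_cont: "continuous_on {\<tau> i..\<tau> (Suc i)} \<eta>" if "i < m" for i
    by (rule continuous_on_vector_derivative[OF \<eta>[OF that]])
  define j where "j i t = lam t * (Lx i t \<bullet> \<eta> t + Lv i t \<bullet> g i t)" for i t
  have j_cont: "continuous_on {\<tau> i..\<tau> (Suc i)} (j i)" if "i < m" for i
    unfolding j_def[abs_def] by (intro continuous_intros lam_cont Lx_cont Lv_cont \<eta>_cont g_cont that)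
  obtain J where J0: "J (\<tau> 0) = 0" and J: "\<And>i t. i < m \<Longrightarrow> t \<in> {\<tau> i..\<tau> (Suc i)} \<Longrightarrow>
      (J has_vector_derivative j i t) (at t within {\<tau> i..\<tau> (Suc i)})"
    by (rule piecewise_antiderivative[where f = j and \<tau> = \<tau> and m = m, OF arc(1) j_cont]) (assumption, assumption, rule that)
  have Jb: "J b = 0"
  proof (rule first_variation_zero[OF ab L ext ends arcs \<eta> g_cont])
    show "\<eta> a = 0" "J a = 0" using \<eta>0 J0 ends by auto
    show "lam t > 0" for t by (rule lam_pos)
    fix i t assume it: "i < m" "t \<in> {\<tau> i..\<tau> (Suc i)}"
    show "(lam has_real_derivative - lam t * along {\<tau> i..\<tau> (Suc i)} (dL_dz L) x z t)
          (at t within {\<tau> i..\<tau> (Suc i)})"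
      using lam[OF it] by (simp add: Lz_def)
    show "(J has_real_derivative lam t * (along {\<tau> i..\<tau> (Suc i)} (dL_dx L) x z t \<bullet> \<eta> t
            + along {\<tau> i..\<tau> (Suc i)} (dL_dv L) x z t \<bullet> g i t)) (at t within {\<tau> i..\<tau> (Suc i)})"
      using J[OF it] by (simp add: j_def Lx_def Lv_def has_real_derivative_iff_has_vector_derivative)
  qed
  have g_zero: "g i t = 0" if it: "i < m" "t \<in> {\<tau> i..\<tau> (Suc i)}" for i t
  proof -
    \<comment> \<open>The integration by parts in differential form: the derivative of J + P
      \<bullet> \<eta> is lam (Lx \<bullet> \<eta> + Lv \<bullet> g) - lam Lx \<bullet> \<eta> + P
      \<bullet> g, which equals (lam Lv + P) \<bullet> g, the square of the norm of g. Both end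
      values are zero.\<close>
    have "(norm (g i t))\<^sup>2 = 0"
    proof (rule derivative_zero_of_equal_ends[where \<Phi> = "\<lambda>t. J t + P t \<bullet> \<eta> t"
          and \<Phi>' = "\<lambda>i t. (norm (g i t))\<^sup>2" and m = m and \<tau> = \<tau>])
      fix i t assume it: "i < m" "t \<in> {\<tau> i..\<tau> (Suc i)}"
      have "((\<lambda>t. P t \<bullet> \<eta> t) has_vector_derivative P t \<bullet> g i t + (- (lam t *\<^sub>R Lx i t)) \<bullet> \<eta> t)
          (at t within {\<tau> i..\<tau> (Suc i)})"
        by (rule bounded_bilinear.has_vector_derivative[OF bounded_bilinear_inner P[OF it] \<eta>[OF it]])
      from has_vector_derivative_add[OF J[OF it] this]
      show "((\<lambda>t. J t + P t \<bullet> \<eta> t) has_vector_derivative (norm (g i t))\<^sup>2)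
          (at t within {\<tau> i..\<tau> (Suc i)})"
        by (simp add: j_def g_def power2_norm_eq_inner inner_add_left algebra_simps)
    next
      show "J (\<tau> 0) + P (\<tau> 0) \<bullet> \<eta> (\<tau> 0) = J (\<tau> m) + P (\<tau> m) \<bullet> \<eta> (\<tau> m)"
        using J0 \<eta>0 Jb ends by (simp add: P_def)
    qed (use it arc(1) in auto)
    then show ?thesis by simp
  qed
  have Lv_eq: "Lv i t = - (exp (\<Lambda> t) *\<^sub>R P t)" if "t \<in> {\<tau> i..\<tau> (Suc i)}" for t
  proof -
    have "exp (\<Lambda> t) *\<^sub>R g i t = 0" using g_zero[OF i that] by simp
    then have "Lv i t + exp (\<Lambda> t) *\<^sub>R P t = 0"
      by (simp add: g_def lam_def scaleR_add_right exp_minus)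
    then show ?thesis by (simp add: eq_neg_iff_add_eq_0)
  qed
  show "along {\<tau> i..b} (dL_dv L) x z b = 0" if "\<tau> (Suc i) = b"
    using Lv_eq[of b] arc(1)[OF i] that by (simp add: Lv_def P_def)
  assume t: "t \<in> {\<tau> i..\<tau> (Suc i)}"
  have "(\<Lambda> has_real_derivative Lz i t) (at t within {\<tau> i..\<tau> (Suc i)})"
    using \<Lambda>[OF i t] by (simp add: has_real_derivative_iff_has_vector_derivative)
  then have "((\<lambda>t. exp (\<Lambda> t)) has_real_derivative exp (\<Lambda> t) * Lz i t) (at t within {\<tau> i..\<tau> (Suc i)})"
    by (auto intro!: derivative_eq_intros)
  \<comment> \<open>In the product rule \<open>exp (\<Lambda> t)\<close> cancels
    \<open>lam t\<close> in the term with P', which gives Lx; the other term is Lz times -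
    exp(\<Lambda>) P, and that is Lz Lv.\<close>
  from has_vector_derivative_minus[OF has_vector_derivative_scaleR[OF this P[OF i t]]]
  have deriv: "((\<lambda>t. - (exp (\<Lambda> t) *\<^sub>R P t)) has_vector_derivative Lx i t + Lz i t *\<^sub>R Lv i t)
      (at t within {\<tau> i..\<tau> (Suc i)})"
    using Lv_eq[OF t] by (simp add: lam_def exp_minus mult.commute)
  have "(Lv i has_vector_derivative Lx i t + Lz i t *\<^sub>R Lv i t) (at t within {\<tau> i..\<tau> (Suc i)})"
    by (rule has_vector_derivative_transform[OF t _ deriv]) (rule Lv_eq)
  then show "\<exists>D. (along {\<tau> i..\<tau> (Suc i)} (dL_dv L) x z has_vector_derivative D) (at t within {\<tau> i..\<tau> (Suc i)}) \<and>
        along {\<tau> i..\<tau> (Suc i)} (dL_dx L) x z t - D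
          + along {\<tau> i..\<tau> (Suc i)} (dL_dz L) x z t *\<^sub>R along {\<tau> i..\<tau> (Suc i)} (dL_dv L) x z t = 0"
    unfolding Lx_def Lv_def Lz_def by (intro exI conjI) (assumption, simp)
qed

theorem theorem4:
  fixes L :: "real \<Rightarrow> real^'n \<Rightarrow> real^'n \<Rightarrow> real \<Rightarrow> real"
    and a b \<gamma> :: real and \<alpha> :: "real^'n"
    and x :: "real \<Rightarrow> real^'n" and z :: "real \<Rightarrow> real"
  assumes "a < b"
    and "C1_lagrangian a b L"
    and "extremizer a b L \<alpha> \<gamma> x z"
  shows "(\<forall>c d. smooth_arc a b x z c d \<longrightarrow>
            (\<forall>t\<in>{c..d}. \<exists>D.
               (along {c..d} (dL_dv L) x z has_vector_derivative D) (at t within {c..d}) \<and>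
               along {c..d} (dL_dx L) x z t - D
                 + along {c..d} (dL_dz L) x z t *\<^sub>R along {c..d} (dL_dv L) x z t = 0))
         \<and> along {a..b} (dL_dv L) x z b = 0"
proof (intro conjI allI impI ballI)
  have pc: "PC1 a b x" "PC1 a b z"
    using assms(3) by (auto simp: extremizer_def admissible_def)
  {
    fix c d t assume arc: "smooth_arc a b x z c d" and t: "t \<in> {c..d}"
    obtain m \<tau> where \<tau>: "\<tau> (0 :: nat) = a" "\<tau> m = b"
      "\<And>i. i < m \<Longrightarrow> smooth_arc a b x z (\<tau> i) (\<tau> (Suc i))" "\<exists>i<m. \<tau> i = c \<and> \<tau> (Suc i) = d"
      by (rule smooth_partition_containing_arc[OF pc arc]) (rule that)
    obtain i where i: "i < m" "\<tau> i = c" "\<tau> (Suc i) = d" using \<tau>(4) by blast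
    show "\<exists>D. (along {c..d} (dL_dv L) x z has_vector_derivative D) (at t within {c..d}) \<and>
               along {c..d} (dL_dx L) x z t - D
                 + along {c..d} (dL_dz L) x z t *\<^sub>R along {c..d} (dL_dv L) x z t = 0"
      using euler_lagrange_on_partition(1)[OF assms \<tau>(1-3) i(1), of t] t i(2,3) by simp
  }
  \<comment> \<open>For transversality any partition serves, since only its last piece is
    used.\<close>
  obtain d where "smooth_arc a b x z a d"
    by (rule smooth_arc_exists[OF assms(1) pc])
  obtain m \<tau> where \<tau>: "\<tau> (0 :: nat) = a" "\<tau> m = b"
    "\<And>i. i < m \<Longrightarrow> smooth_arc a b x z (\<tau> i) (\<tau> (Suc i))"
    by (rule smooth_partition_containing_arc[OF pc \<open>smooth_arc a b x z a d\<close>]) (rule that)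
  obtain i where i: "m = Suc i" using \<tau>(1,2) assms(1) by (cases m) auto
  have "\<tau> i < b" using \<tau>(3)[of i] \<tau>(2) i by (simp add: smooth_arc_def)
  \<comment> \<open>The claim uses x' within [a,b], although \<open>x\<close> may have corners
    there. At b only the left-hand germ counts, so this is the derivative within the last
    piece.\<close>
  then have "at b within {\<tau> i..b} = at b within {a..b}"
    using assms(1) by (simp add: at_within_Icc_at_left)
  then have "along {a..b} (dL_dv L) x z b = along {\<tau> i..b} (dL_dv L) x z b"
    by (simp add: along_def)
  also have "\<dots> = 0"
    using euler_lagrange_on_partition(2)[OF assms \<tau>(1-3), of i] \<tau>(2) i by simp
  finally show "along {a..b} (dL_dv L) x z b = 0" .
qed

end
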